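(* Fix an integer $p\ge2$ and real $\beta_1,\beta_2$, and let $X$ be distributed according to $\mathbb{P}_n=\mathbb{P}_{n,\beta_1,\beta_2}$. If $(\beta_1,\beta_2)$ is off the phase transition curve or is the critical point, then $$\lim_{n\to\infty}\mathbb{P}_n(X_{12}=1)=x^*.$$ If $(\beta_1,\beta_2)$ is on the phase transition curve but is not the critical point, then $$\lim_{n\to\infty}\mathbb{P}_n(X_{12}=1)=\alpha x_1^*+(1-\alpha)x_2^*,$$ where $$\alpha:=\frac{\sqrt{x_2^*(1-x_2^* )|\ell''(x_2^* )|}}{\sqrt{x_1^*(1-x_1^* )|\ell''(x_1^* )|}+\sqrt{x_2^*(1-x_2^* )|\ell''(x_2^* )|}}.$$
   Context: For $n\ge 2$, a directed graph (loops allowed, no duplicate edges) on $n$ nodes is identified with its adjacency matrix $X=(X_{ij})_{1\le i,j\le n}\in\{0,1\}^{n\times n}$. Set $$e(X)=n^{-2}\sum_{1\le i,j\le n}X_{ij},\qquad s(X)=n^{-p-1}\sum_{1\le i,j_1,\dots,j_p\le n}X_{ij_1}X_{ij_2}\cdots X_{ij_p}.$$ $\mathbb{P}_{n,\beta_1,\beta_2}$ is the probability measure on $\{0,1\}^{n\times n}$ with $\mathbb{P}_{n,\beta_1,\beta_2}(X)=Z_n(\beta_1,\beta_2)^{-1}\exp[n^2(\beta_1e(X)+\beta_2s(X))]$, where $Z_n(\beta_1,\beta_2)$ is the normalization constant. The function $\ell:[0,1]\to\mathbb{R}$ is $\ell(x)=\beta_1x+\beta_2x^p-x\log x-(1-x)\log(1-x)$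 (with $0\log0=0$); $\ell''$ is its second derivative in $x$. Phase transition curve: by a known result of Radin and Yin there is a curve in the $(\beta_1,\beta_2)$-plane, of the form $\beta_2=q(\beta_1)$ for $\beta_1\le\beta_1^c$, with endpoint (the critical point) $$(\beta_1^c,\beta_2^c)=\left(\log(p-1)-\frac{p}{p-1},\ \frac{p^{p-1}}{(p-1)^p}\right),$$ such that off the curve and at the endpoint $\ell$ has a unique global maximizer $x^*\in(0,1)$, while on the curve away from the endpoint $\ell$ has exactly two global maximizers $x_1^*,x_2^*$, with $0<x_1^*<\frac{p-1}{p}<x_2^*<1$. *)

theory Defs
  imports "HOL-Probability.Probability"
begin

text \<open>
  A directed graph on the nodes \<open>{1..n}\<close> is its adjacency matrix, a function on pairs of
  nodes with values in \<open>{0, 1}\<close>, extensional outside \<open>{1..n} \<times> {1..n}\<close>.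
\<close>

definition digraphs :: "nat \<Rightarrow> (nat \<times> nat \<Rightarrow> real) set" where
  "digraphs n = ({1..n} \<times> {1..n}) \<rightarrow>\<^sub>E {0, 1}"

definition edge_density :: "nat \<Rightarrow> (nat \<times> nat \<Rightarrow> real) \<Rightarrow> real" where
  "edge_density n X = (\<Sum>i\<in>{1..n}. \<Sum>j\<in>{1..n}. X (i, j)) / real n ^ 2"

text \<open>The inner sum ranges over all tuples \<open>(j\<^sub>1, \<dots>, j\<^sub>p)\<close> of nodes.\<close>

definition star_density :: "nat \<Rightarrow> nat \<Rightarrow> (nat \<times> nat \<Rightarrow> real) \<Rightarrow> real" where
  "star_density p n X =
     (\<Sum>i\<in>{1..n}. \<Sum>j\<in>{1..p} \<rightarrow>\<^sub>E {1..n}. \<Prod>k\<in>{1..p}. X (i, j k)) / real n ^ (p + 1)"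

definition gibbs_weight ::
  "nat \<Rightarrow> real \<Rightarrow> real \<Rightarrow> nat \<Rightarrow> (nat \<times> nat \<Rightarrow> real) \<Rightarrow> real" where
  "gibbs_weight p \<beta>1 \<beta>2 n X =
     exp (real n ^ 2 * (\<beta>1 * edge_density n X + \<beta>2 * star_density p n X))"

definition partition_function :: "nat \<Rightarrow> real \<Rightarrow> real \<Rightarrow> nat \<Rightarrow> real" where
  "partition_function p \<beta>1 \<beta>2 n = (\<Sum>X\<in>digraphs n. gibbs_weight p \<beta>1 \<beta>2 n X)"

definition ergm :: "nat \<Rightarrow> real \<Rightarrow> real \<Rightarrow> nat \<Rightarrow> (nat \<times> nat \<Rightarrow> real) measure" where
  "ergm p \<beta>1 \<beta>2 n = point_measure (digraphs n)
     (\<lambda>X. ennreal (gibbs_weight p \<beta>1 \<beta>2 n X / partition_function p \<beta>1 \<beta>2 n))"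

lemma finite_digraphs: "finite (digraphs n)"
  unfolding digraphs_def by (intro finite_PiE) auto

lemma partition_function_pos: "0 < partition_function p \<beta>1 \<beta>2 n"
proof -
  have "digraphs n \<noteq> {}"
    by (auto simp: digraphs_def PiE_eq_empty_iff)
  then show ?thesis
    unfolding partition_function_def
    by (intro sum_pos finite_digraphs) (auto simp: gibbs_weight_def)
qed

lemma prob_space_ergm: "prob_space (ergm p \<beta>1 \<beta>2 n)"
proof
  have "(\<Sum>X\<in>digraphs n. ennreal (gibbs_weight p \<beta>1 \<beta>2 n X / partition_function p \<beta>1 \<beta>2 n))
      = ennreal (\<Sum>X\<in>digraphs n. gibbs_weight p \<beta>1 \<beta>2 n X / partition_function p \<beta>1 \<beta>2 n)"
    using partition_function_pos[of p \<beta>1 \<beta>2 n]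
    by (intro sum_ennreal) (auto simp: gibbs_weight_def)
  also have "\<dots> = 1"
    using partition_function_pos[of p \<beta>1 \<beta>2 n]
    by (simp flip: sum_divide_distrib partition_function_def)
  finally show "emeasure (ergm p \<beta>1 \<beta>2 n) (space (ergm p \<beta>1 \<beta>2 n)) = 1"
    by (simp add: ergm_def space_point_measure emeasure_point_measure_finite finite_digraphs)
qed

text \<open>The convention \<open>0 log 0 = 0\<close> at both endpoints holds because of the factor \<open>0\<close>.\<close>

definition ell :: "nat \<Rightarrow> real \<Rightarrow> real \<Rightarrow> real \<Rightarrow> real" where
  "ell p \<beta>1 \<beta>2 x = \<beta>1 * x + \<beta>2 * x ^ p - x * ln x - (1 - x) * ln (1 - x)"

definition global_maximizers :: "nat \<Rightarrow> real \<Rightarrow> real \<Rightarrow> real set" where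
  "global_maximizers p \<beta>1 \<beta>2 =
     {x \<in> {0..1}. \<forall>y\<in>{0..1}. ell p \<beta>1 \<beta>2 y \<le> ell p \<beta>1 \<beta>2 x}"

definition crit1 :: "nat \<Rightarrow> real" where
  "crit1 p = ln (real p - 1) - real p / (real p - 1)"

definition crit2 :: "nat \<Rightarrow> real" where
  "crit2 p = real p ^ (p - 1) / (real p - 1) ^ p"

definition on_curve :: "nat \<Rightarrow> (real \<Rightarrow> real) \<Rightarrow> real \<Rightarrow> real \<Rightarrow> bool" where
  "on_curve p q \<beta>1 \<beta>2 \<longleftrightarrow> \<beta>1 \<le> crit1 p \<and> \<beta>2 = q \<beta>1"

definition critical_point :: "nat \<Rightarrow> real \<Rightarrow> real \<Rightarrow> bool" where
  "critical_point p \<beta>1 \<beta>2 \<longleftrightarrow> \<beta>1 = crit1 p \<and> \<beta>2 = crit2 p"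

text \<open>
  The graph of \<open>q\<close> over \<open>{..crit1 p}\<close> is the phase transition curve. A function \<open>q\<close> with this
  property exists for every \<open>p \<ge> 2\<close> by a theorem of Radin and Yin. The property determines
  \<open>q\<close> on \<open>{..crit1 p}\<close>: to the left of the critical point, \<open>q \<beta>1\<close> is the only value of \<open>\<beta>2\<close>
  for which \<^term>\<open>ell p \<beta>1 \<beta>2\<close> has two global maximizers.
\<close>

definition phase_transition_curve :: "nat \<Rightarrow> (real \<Rightarrow> real) \<Rightarrow> bool" where
  "phase_transition_curve p q \<longleftrightarrow>
     q (crit1 p) = crit2 p \<and>
     (\<forall>\<beta>1 \<beta>2. \<not> on_curve p q \<beta>1 \<beta>2 \<or> critical_point p \<beta>1 \<beta>2 \<longrightarrow>
        (\<exists>x. 0 < x \<and> x < 1 \<and> global_maximizers p \<beta>1 \<beta>2 = {x})) \<and>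
     (\<forall>\<beta>1 \<beta>2. on_curve p q \<beta>1 \<beta>2 \<and> \<not> critical_point p \<beta>1 \<beta>2 \<longrightarrow>
        (\<exists>x1 x2. 0 < x1 \<and> x1 < (real p - 1) / real p \<and> (real p - 1) / real p < x2 \<and> x2 < 1 \<and>
           global_maximizers p \<beta>1 \<beta>2 = {x1, x2}))"

definition laplace_factor :: "nat \<Rightarrow> real \<Rightarrow> real \<Rightarrow> real \<Rightarrow> real" where
  "laplace_factor p \<beta>1 \<beta>2 x = sqrt (x * (1 - x) * \<bar>deriv (deriv (ell p \<beta>1 \<beta>2)) x\<bar>)"

definition mixture_weight :: "nat \<Rightarrow> real \<Rightarrow> real \<Rightarrow> real \<Rightarrow> real \<Rightarrow> real" where
  "mixture_weight p \<beta>1 \<beta>2 x1 x2 =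
     laplace_factor p \<beta>1 \<beta>2 x2 / (laplace_factor p \<beta>1 \<beta>2 x1 + laplace_factor p \<beta>1 \<beta>2 x2)"

text \<open>The edge from node 1 to node 2 only makes sense for \<open>n \<ge> 2\<close>; smaller \<open>n\<close> do not affect limits.\<close>

definition edge_probability :: "nat \<Rightarrow> real \<Rightarrow> real \<Rightarrow> nat \<Rightarrow> real" where
  "edge_probability p \<beta>1 \<beta>2 n =
     measure (ergm p \<beta>1 \<beta>2 n) {X \<in> space (ergm p \<beta>1 \<beta>2 n). X (1, 2) = 1}"

end

(*
  Since the star count only involves edges leaving a common node, the Gibbs weight factorizes over
  the rows of the adjacency matrix. Hence row 1 is a vector of n exchangeable bits whose sum k has
  weight C(n,k) exp(n f(k/n)) with f(y) = beta1 y + beta2 y^p, and P(X_12 = 1) is the mean of k/n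
  under these weights. By Stirling's formula the weight of k is about
  n^(-1/2) exp(n ell(k/n)) / sqrt(y(1-y)) with y = k/n, up to a constant factor. With one maximizer
  the weights concentrate there at an exponential rate. With two maximizers ell'' is negative at
  both, and Laplace's method gives each a mass proportional to 1 / sqrt(x(1-x)|ell''(x)|). The
  constant in Stirling's formula cancels, so only its existence is needed.
*)

theory Submission
  imports Defs
begin

section \<open>Binomial coefficients and entropy\<close>

text \<open>The case of one maximizer contains the critical point, where ell'' vanishes at the
  maximizer (p - 1) / p and quadratic Laplace asymptotics break down. That case therefore compares
  exponential rates only and uses no derivative of \<open>ell\<close>. On the rest of the curve the
  maximizers lie strictly on either side of (p - 1) / p, and this position is what yields ell'' < 0.
  The weights enter only through quotients, so a common factor exp(-n l) may be inserted. With one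
  maximizer, l is taken strictly between the maximum of \<open>ell\<close> and its supremum away
  from the maximizer: the tail then vanishes while the total stays at least 1. With two maximizers,
  l is the maximum itself, so that the sums converge to positive limits. The Stirling form of the
  binomial coefficient degenerates at k = 0 and k = n. It is used only near interior points; the
  tails rely on the cruder bound C(n,k) <= exp(n H(k/n)), where H is the entropy.\<close>

definition stirling_error :: "nat \<Rightarrow> real" where
  "stirling_error n = ln (fact n) - (real n + 1 / 2) * ln (real n) + real n"

lemma ln_one_plus_inverse:
  assumes "n > 0"
  shows "ln (1 + 1 / real n) = ln (real n + 1) - ln (real n)"
  using assms by (subst ln_divide_pos [symmetric]) (auto simp: field_simps)

lemma stirling_error_diff:
  assumes "n > 0"
  shows "stirling_error n - stirling_error (Suc n) = (real n + 1 / 2) * ln (1 + 1 / real n) - 1"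
proof -
  have "ln (fact (Suc n) :: real) = ln (fact n) + ln (real n + 1)"
    using ln_mult[of "real n + 1" "fact n"] by (simp add: add.commute)
  then show ?thesis
    unfolding stirling_error_def ln_one_plus_inverse[OF assms] by (simp add: algebra_simps)
qed

text \<open>The midpoint rule underestimates the integral of the convex function 1/x over
  [n, n + 1], and n + 1/2 is the reciprocal of the midpoint value.\<close>

lemma stirling_error_decreasing:
  assumes "n > 0"
  shows "stirling_error (Suc n) \<le> stirling_error n"
proof -
  have "2 / (2 * real n + 1) \<le> ln (1 + 1 / real n)"
    using ln_inverse_approx_ge[of "real n" "real n + 1"] assms
    by (simp add: ln_one_plus_inverse add.commute)
  then have "(real n + 1 / 2) * (2 / (2 * real n + 1)) \<le> (real n + 1 / 2) * ln (1 + 1 / real n)"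
    by (intro mult_left_mono) auto
  moreover have "(real n + 1 / 2) * (2 / (2 * real n + 1)) = 1" by (simp add: field_simps)
  ultimately show ?thesis using stirling_error_diff[OF assms] by linarith
qed

text \<open>The trapezoidal rule overestimates the same integral. After multiplication by n + 1/2
  its excess over 1 is 1 / (4 n (n + 1)), which telescopes into the correction 1 / (4 n).\<close>

lemma stirling_error_corrected_increasing:
  assumes "n > 0"
  shows "stirling_error n - 1 / (4 * real n) \<le> stirling_error (Suc n) - 1 / (4 * real (Suc n))"
proof -
  have "ln (1 + 1 / real n) \<le> (1 / real n + 1 / (real n + 1)) / 2"
    using ln_inverse_approx_le[of "real n" 1] assms
    by (simp add: ln_one_plus_inverse inverse_eq_divide)
  then have "(real n + 1 / 2) * ln (1 + 1 / real n)
      \<le> (real n + 1 / 2) * ((1 / real n + 1 / (real n + 1)) / 2)"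
    by (intro mult_left_mono) auto
  moreover have "(real n + 1 / 2) * ((1 / real n + 1 / (real n + 1)) / 2) - 1
      = 1 / (4 * real n) - 1 / (4 * real (Suc n))"
    using assms by (simp add: divide_simps) (simp add: algebra_simps)?
  ultimately show ?thesis using stirling_error_diff[OF assms] by linarith
qed

text \<open>At n = 1 the error is 1 and the corrected error is 1 - 1/4; monotonicity does the rest.
  The interval is narrow enough that 1 - 3/4 - 3/4 < 0, which later bounds the error factor of a
  binomial coefficient by 1.\<close>

lemma stirling_error_bounds:
  assumes "n > 0"
  shows "3 / 4 \<le> stirling_error n" "stirling_error n \<le> 1"
proof -
  have 1: "stirling_error (Suc 0) = 1" by (simp add: stirling_error_def)
  have "3 / 4 \<le> stirling_error (Suc m) - 1 / (4 * real (Suc m)) \<and> stirling_error (Suc m) \<le> 1" for m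
  proof (induction m)
    case 0 then show ?case by (simp add: 1)
  next
    case (Suc m)
    then show ?case
      using stirling_error_decreasing[of "Suc m"] stirling_error_corrected_increasing[of "Suc m"]
      by linarith
  qed
  moreover obtain m where "n = Suc m" using assms gr0_implies_Suc by blast
  moreover have "1 / (4 * real (Suc m)) > 0" for m by simp
  ultimately show "3 / 4 \<le> stirling_error n" "stirling_error n \<le> 1"
    by (smt (verit))+
qed

lemma convergent_stirling_error: "convergent stirling_error"
proof -
  \<comment> \<open>The shift skips index 0, where the convention \<open>ln 0 = 0\<close> gives the
    error 0, below the lower bound.\<close>
  have "decseq (\<lambda>n. stirling_error (Suc n))"
    by (intro decseq_SucI stirling_error_decreasing) simp
  moreover have "\<forall>n. 3 / 4 \<le> stirling_error (Suc n)"
    by (intro allI stirling_error_bounds) simp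
  ultimately obtain d where "(\<lambda>n. stirling_error (Suc n)) \<longlonglongrightarrow> d"
    using decseq_convergent by metis
  then show ?thesis
    using filterlim_sequentially_Suc convergent_def by blast
qed

section \<open>Entropy estimates for binomial coefficients\<close>

definition binary_entropy :: "real \<Rightarrow> real" where
  "binary_entropy x = - x * ln x - (1 - x) * ln (1 - x)"

lemma fact_eq_stirling_error:
  assumes "n > 0"
  shows "fact n = exp (real n * ln (real n) - real n + stirling_error n) * sqrt (real n)"
proof -
  have "sqrt (real n) = exp (ln (real n) / 2)"
    using assms by (simp add: ln_sqrt [symmetric])
  then have "exp (real n * ln (real n) - real n + stirling_error n) * sqrt (real n)
    = exp (ln (fact n))"
    by (simp add: stirling_error_def algebra_simps flip: exp_add)
  then show ?thesis by simp
qed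

text \<open>Exact, because the three Stirling errors are carried along. The linear terms and the
  multiples of ln n cancel, since n = k + (n - k). The square roots leave
  \<open>1 / sqrt (n * y * (1 - y))\<close>, and the factor \<open>sqrt n\<close> on the left
  removes the n.\<close>

lemma binomial_eq_entropy:
  assumes "0 < k" "k < n"
  defines "y \<equiv> real k / real n"
  shows "sqrt (real n) * real (n choose k) * exp (- real n * binary_entropy y) =
    exp (stirling_error n - stirling_error k - stirling_error (n - k)) / sqrt (y * (1 - y))"
proof -
  have n: "n > 0" and nk: "n - k > 0" and kr: "real (n - k) = real n - real k" using assms by auto
  have y: "y > 0" "1 - y > 0"
    using assms by (auto simp: y_def field_simps)
  have k_eq: "real k = real n * y" and nk_eq: "real (n - k) = real n * (1 - y)"
    using n kr by (auto simp: y_def field_simps)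
  have lnk: "ln (real k) = ln (real n) + ln y" "ln (real (n - k)) = ln (real n) + ln (1 - y)"
    using n y unfolding k_eq nk_eq by (auto simp: ln_mult)
  have "real (n choose k) = fact n / (fact k * fact (n - k))"
    using assms by (simp add: binomial_fact)
  also have "\<dots> = exp (real n * ln (real n) - real n + stirling_error n
      - (real k * ln (real k) - real k + stirling_error k)
      - (real (n - k) * ln (real (n - k)) - real (n - k) + stirling_error (n - k)))
      * (sqrt (real n) / (sqrt (real k) * sqrt (real (n - k))))"
    unfolding fact_eq_stirling_error[OF n] fact_eq_stirling_error[OF assms(1)]
      fact_eq_stirling_error[OF nk] exp_diff by simp
  also have "real n * ln (real n) - real n + stirling_error n
      - (real k * ln (real k) - real k + stirling_error k)
      - (real (n - k) * ln (real (n - k)) - real (n - k) + stirling_error (n - k))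
    = real n * binary_entropy y + (stirling_error n - stirling_error k - stirling_error (n - k))"
    unfolding lnk binary_entropy_def unfolding k_eq nk_eq by (simp add: algebra_simps)
  also have "sqrt (real n) / (sqrt (real k) * sqrt (real (n - k)))
      = 1 / (sqrt (real n) * sqrt (y * (1 - y)))"
    unfolding k_eq nk_eq real_sqrt_mult using n y by (simp add: divide_simps)
  finally have "real (n choose k) = exp (real n * binary_entropy y) *
      exp (stirling_error n - stirling_error k - stirling_error (n - k))
      * (1 / (sqrt (real n) * sqrt (y * (1 - y))))"
    by (simp add: exp_add)
  then show ?thesis
    using n y by (simp add: exp_minus field_simps)
qed

text \<open>A single probability of the binomial distribution with success probability k/n is at
  most 1. Unlike the Stirling identity, this covers k = 0 and k = n, which the tail estimate
  needs.\<close>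

lemma binomial_le_exp_entropy:
  assumes "k \<le> n" "n > 0"
  shows "real (n choose k) \<le> exp (real n * binary_entropy (real k / real n))"
proof (cases "k = 0 \<or> k = n")
  case True
  then show ?thesis using assms by (auto simp: binary_entropy_def)
next
  case False
  define y where "y = real k / real n"
  have y: "0 < y" "y < 1" using assms False by (auto simp: y_def)
  have eqs: "real n * y = real k" "real n * (1 - y) = real (n - k)"
    using assms by (auto simp: y_def field_simps of_nat_diff)
  have "real (n choose k) * y ^ k * (1 - y) ^ (n - k)
      \<le> (\<Sum>j\<le>n. real (n choose j) * y ^ j * (1 - y) ^ (n - j))"
    using y assms by (intro member_le_sum) auto
  also have "\<dots> = 1" using binomial_ring[of y "1 - y" n] by simp
  finally have 1: "real (n choose k) * (y ^ k * (1 - y) ^ (n - k)) \<le> 1" by (simp add: mult.assoc)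
  have "exp (- (real n * binary_entropy y)) = exp (real k * ln y + real (n - k) * ln (1 - y))"
    unfolding binary_entropy_def eqs[symmetric] by (simp add: algebra_simps)
  also have "\<dots> = y ^ k * (1 - y) ^ (n - k)"
    using y by (simp add: exp_add exp_of_nat_mult)
  finally have "real (n choose k) * exp (- (real n * binary_entropy y)) \<le> 1" using 1 by simp
  then show ?thesis by (simp add: y_def exp_minus field_simps)
qed

text \<open>Uniform in n and k, for the dominating function in Laplace's method: the exponent of the
  error factor is at most 1 - 3/4 - 3/4.\<close>

lemma binomial_entropy_bound:
  assumes "0 < k" "k < n"
  defines "y \<equiv> real k / real n"
  shows "sqrt (real n) * real (n choose k) * exp (- real n * binary_entropy y)
    \<le> 1 / sqrt (y * (1 - y))"
proof -
  have "0 < y" "y < 1" using assms by (auto simp: y_def)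
  moreover have "exp (stirling_error n - stirling_error k - stirling_error (n - k)) \<le> 1"
    using stirling_error_bounds[of n] stirling_error_bounds[of k] stirling_error_bounds[of "n - k"] assms
    by simp
  ultimately show ?thesis
    unfolding y_def binomial_eq_entropy[OF assms(1,2)] by (intro divide_right_mono) auto
qed

lemma filterlim_at_top_real_of_nat:
  fixes k :: "nat \<Rightarrow> nat"
  assumes "filterlim (\<lambda>n. real (k n)) at_top F"
  shows "filterlim k at_top F"
  using assms unfolding filterlim_at_top
  by (metis (mono_tags, lifting) eventually_mono of_nat_le_iff)

text \<open>As x is interior, both k and n - k tend to infinity. All three Stirling errors then
  share one limit d, and the exponent tends to d - d - d = -d.\<close>

lemma binomial_entropy_tendsto:
  fixes k :: "nat \<Rightarrow> nat"
  assumes x: "0 < x" "x < 1" and lim: "(\<lambda>n. real (k n) / real n) \<longlonglongrightarrow> x"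
  shows "(\<lambda>n. sqrt (real n) * real (n choose k n) *
      exp (- real n * binary_entropy (real (k n) / real n)))
    \<longlonglongrightarrow> exp (- lim stirling_error) / sqrt (x * (1 - x))"
proof -
  let ?d = "lim stirling_error"
  have d: "stirling_error \<longlonglongrightarrow> ?d"
    using convergent_stirling_error by (simp add: convergent_LIMSEQ_iff)
  have ev: "eventually (\<lambda>n. 0 < k n \<and> k n < n) sequentially"
  proof -
    have "eventually (\<lambda>n. 0 < real (k n) / real n \<and> real (k n) / real n < 1 \<and> 0 < n) sequentially"
      using order_tendstoD[OF lim] x eventually_gt_at_top[of 0] by (intro eventually_conj) auto
    then show ?thesis by eventually_elim (auto simp: field_simps zero_less_divide_iff)
  qed
  have "filterlim (\<lambda>n. real (k n) / real n * real n) at_top sequentially"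
    using x by (intro filterlim_tendsto_pos_mult_at_top[OF lim] filterlim_real_sequentially)
  moreover have "eventually (\<lambda>n. real (k n) / real n * real n = real (k n)) sequentially"
    using ev by eventually_elim auto
  ultimately have "filterlim (\<lambda>n. real (k n)) at_top sequentially"
    by (simp cong: filterlim_cong)
  then have k_top: "filterlim k at_top sequentially"
    by (rule filterlim_at_top_real_of_nat)
  have "filterlim (\<lambda>n. (1 - real (k n) / real n) * real n) at_top sequentially"
    using x by (intro filterlim_tendsto_pos_mult_at_top[OF tendsto_diff[OF tendsto_const lim]]
        filterlim_real_sequentially) auto
  moreover have "eventually (\<lambda>n. (1 - real (k n) / real n) * real n = real (n - k n)) sequentially"
    using ev by eventually_elim (auto simp: field_simps)
  ultimately have "filterlim (\<lambda>n. real (n - k n)) at_top sequentially"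
    by (simp cong: filterlim_cong)
  then have nk_top: "filterlim (\<lambda>n. n - k n) at_top sequentially"
    by (rule filterlim_at_top_real_of_nat)
  have "(\<lambda>n. exp (stirling_error n - stirling_error (k n) - stirling_error (n - k n))
      / sqrt (real (k n) / real n * (1 - real (k n) / real n)))
    \<longlonglongrightarrow> exp (?d - ?d - ?d) / sqrt (x * (1 - x))"
    using x by (intro tendsto_intros d lim filterlim_compose[OF d k_top] filterlim_compose[OF d nk_top]) auto
  moreover have "eventually (\<lambda>n. exp (stirling_error n - stirling_error (k n) - stirling_error (n - k n))
      / sqrt (real (k n) / real n * (1 - real (k n) / real n)) =
      sqrt (real n) * real (n choose k n) *
      exp (- real n * binary_entropy (real (k n) / real n))) sequentially"
    using ev by eventually_elim (simp only: binomial_eq_entropy)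
  ultimately show ?thesis by (simp add: tendsto_cong)
qed

section \<open>Laplace's method for binomial sums\<close>

text \<open>Each k > 0 is taken on an interval of t of length 1/s. The value 0 is taken on a whole
  half-line, because \<open>nat\<close> sends negative floors to 0; hence
  \<open>0 \<notin> K\<close>, which makes \<open>G\<close> vanish there.\<close>

lemma sum_eq_integral_floor:
  fixes G :: "nat \<Rightarrow> real" and c s :: real
  assumes s: "s > 0" and K: "finite K" "0 \<notin> K" and supp: "\<And>k. k \<notin> K \<Longrightarrow> G k = 0"
  shows "(\<lambda>t. G (nat \<lfloor>c + s * t\<rfloor>)) \<in> borel_measurable lborel"
    and "(\<integral>t. G (nat \<lfloor>c + s * t\<rfloor>) \<partial>lborel) = (\<Sum>k\<in>K. G k) / s"
proof -
  define I where "I k = {(real k - c) / s ..< (real k + 1 - c) / s}" for k :: nat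
  have mem: "t \<in> I k \<longleftrightarrow> \<lfloor>c + s * t\<rfloor> = int k" for t k
    unfolding I_def floor_eq_iff using s by (auto simp: field_simps)
  have eq: "G (nat \<lfloor>c + s * t\<rfloor>) = (\<Sum>k\<in>K. G k * indicator (I k) t)" for t
  proof -
    have "(\<Sum>k\<in>K. G k * indicator (I k) t) = (\<Sum>k\<in>K. if k = nat \<lfloor>c + s * t\<rfloor> then G k else 0)"
    proof (rule sum.cong)
      fix k assume k: "k \<in> K"
      then have "k > 0" using K by (metis gr0I)
      then have "t \<in> I k \<longleftrightarrow> k = nat \<lfloor>c + s * t\<rfloor>" unfolding mem by auto
      then show "G k * indicator (I k) t = (if k = nat \<lfloor>c + s * t\<rfloor> then G k else 0)"
        by (simp add: indicator_def)
    qed simp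
    also have "\<dots> = G (nat \<lfloor>c + s * t\<rfloor>)" using K supp by (auto simp: sum.delta)
    finally show ?thesis by simp
  qed
  have I: "has_bochner_integral lborel (indicator (I k) :: real \<Rightarrow> real) (1 / s)" for k
  proof -
    have "emeasure lborel (I k) = ennreal (1 / s)"
      unfolding I_def using s by (subst emeasure_lborel_Ico) (auto simp: field_simps)
    then show ?thesis using s
      by (intro has_bochner_integral_real_indicator[THEN has_bochner_integral_cong[THEN iffD1, rotated -1]])
         (auto simp: measure_def I_def)
  qed
  have "has_bochner_integral lborel (\<lambda>t. \<Sum>k\<in>K. G k * indicator (I k) t) (\<Sum>k\<in>K. G k * (1 / s))"
    by (intro has_bochner_integral_sum has_bochner_integral_mult_right I)
  then show "(\<lambda>t. G (nat \<lfloor>c + s * t\<rfloor>)) \<in> borel_measurable lborel"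
    "(\<integral>t. G (nat \<lfloor>c + s * t\<rfloor>) \<partial>lborel) = (\<Sum>k\<in>K. G k) / s"
    unfolding eq by (auto dest: has_bochner_integral_integral_eq intro: borel_measurable_has_bochner_integral simp: sum_divide_distrib)
qed

lemma has_bochner_integral_exp_neg_square:
  assumes "a > 0"
  shows "has_bochner_integral lborel (\<lambda>t::real. exp (- a * t\<^sup>2)) (sqrt (pi / a))"
proof -
  \<comment> \<open>The normal density with variance 1 / (2 a) has exponent -a t^2 and normalizing
    factor sqrt(a / pi).\<close>
  define \<sigma> where "\<sigma> = 1 / sqrt (2 * a)"
  have \<sigma>: "\<sigma> > 0" "\<sigma>\<^sup>2 = 1 / (2 * a)" using assms by (auto simp: \<sigma>_def power_divide)
  have "has_bochner_integral lborel (normal_density 0 \<sigma>) 1"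
    using \<sigma> by (simp add: has_bochner_integral_iff)
  then have "has_bochner_integral lborel (\<lambda>t. sqrt (pi / a) * normal_density 0 \<sigma> t) (sqrt (pi / a) * 1)"
    by (rule has_bochner_integral_mult_right)
  moreover have "sqrt (pi / a) * normal_density 0 \<sigma> t = exp (- a * t\<^sup>2)" for t
  proof -
    have "2 * pi * \<sigma>\<^sup>2 = pi / a" "(t - 0)\<^sup>2 / (2 * \<sigma>\<^sup>2) = a * t\<^sup>2"
      using assms by (auto simp: \<sigma>(2))
    then show ?thesis using assms by (simp add: normal_density_def)
  qed
  ultimately show ?thesis by simp
qed

text \<open>In the domination argument, rounding moves \<open>t\<close> by at most 1 after rescaling; then
  \<open>y\<^sup>2 \<ge> t\<^sup>2 / 2 - (y - t)\<^sup>2\<close>.\<close>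

lemma exp_neg_square_shift:
  fixes c y t :: real
  assumes "c \<ge> 0" "\<bar>y - t\<bar> \<le> 1"
  shows "exp (- c * y\<^sup>2) \<le> exp c * exp (- (c / 2) * t\<^sup>2)"
proof -
  have "(y - t)\<^sup>2 \<le> 1" using assms(2) by (simp add: abs_square_le_1)
  \<comment> \<open>Half of this square is y^2 - t^2/2 + (y - t)^2.\<close>
  moreover have "0 \<le> (2 * y - t)\<^sup>2" by simp
  ultimately have "t\<^sup>2 / 2 - 1 \<le> y\<^sup>2" by (auto simp: power2_eq_square algebra_simps)
  then have "c * (t\<^sup>2 / 2 - 1) \<le> c * y\<^sup>2" using assms by (intro mult_left_mono) auto
  then show ?thesis by (simp add: algebra_simps flip: exp_add)
qed

text \<open>Rounding costs at most 1, hence at most 1 / sqrt n on the scale of t.\<close>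

lemma nat_floor_scaled_tendsto:
  fixes x t :: real
  assumes x: "x > 0"
  defines "k \<equiv> \<lambda>n. nat \<lfloor>real n * x + sqrt (real n) * t\<rfloor>"
  shows "(\<lambda>n. sqrt (real n) * (real (k n) / real n - x)) \<longlonglongrightarrow> t"
    and "(\<lambda>n. real (k n) / real n) \<longlonglongrightarrow> x"
proof -
  have top: "filterlim (\<lambda>n. sqrt (real n)) at_top sequentially"
    by (intro filterlim_compose[OF sqrt_at_top filterlim_real_sequentially])
  have inv0: "(\<lambda>n. 1 / sqrt (real n)) \<longlonglongrightarrow> 0"
    using tendsto_inverse_0_at_top[OF top] by (simp add: inverse_eq_divide)
  \<comment> \<open>From this threshold on the argument of the floor is nonnegative, so
    \<open>nat\<close> does not truncate it; the extra 1 forces n > 0.\<close>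
  have "eventually (\<lambda>n. sqrt (real n) \<ge> \<bar>t\<bar> / x + 1) sequentially"
    using top by (auto simp: filterlim_at_top)
  then have ev: "eventually (\<lambda>n. real n * x + sqrt (real n) * t \<ge> 0 \<and> n > 0) sequentially"
  proof eventually_elim
    case (elim n)
    have "\<bar>t\<bar> / x + 1 > 0" using x by (auto intro: add_nonneg_pos)
    then have s: "sqrt (real n) > 0" using elim by linarith
    have "\<bar>t\<bar> / x \<le> sqrt (real n)" using elim by simp
    then have "\<bar>t\<bar> \<le> sqrt (real n) * x" using x by (simp add: field_simps)
    then have "sqrt (real n) * (sqrt (real n) * x + t) \<ge> 0" using s by (intro mult_nonneg_nonneg) auto
    then show ?case using s by (simp add: algebra_simps flip: mult.assoc)
  qed
  have bnd: "eventually (\<lambda>n. norm (sqrt (real n) * (real (k n) / real n - x) - t) \<le> 1 / sqrt (real n)) sequentially"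
    using ev
  proof eventually_elim
    case (elim n)
    define z where "z = real n * x + sqrt (real n) * t"
    have n: "sqrt (real n) > 0" "sqrt (real n) * sqrt (real n) = real n" using elim by auto
    have "real (k n) = of_int \<lfloor>z\<rfloor>" using elim by (simp add: k_def z_def)
    then have "\<bar>real (k n) - z\<bar> \<le> 1" by linarith
    moreover have "sqrt (real n) * (real (k n) / real n - x) - t = (real (k n) - z) / sqrt (real n)"
      using n unfolding z_def by (simp add: field_simps)
    ultimately show ?case using n by (simp add: divide_right_mono)
  qed
  have "(\<lambda>n. sqrt (real n) * (real (k n) / real n - x) - t) \<longlonglongrightarrow> 0"
    by (rule Lim_null_comparison[OF bnd inv0])
  then show 1: "(\<lambda>n. sqrt (real n) * (real (k n) / real n - x)) \<longlonglongrightarrow> t"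
    by (simp add: LIM_zero_iff)
  have "(\<lambda>n. 1 / sqrt (real n) * (sqrt (real n) * (real (k n) / real n - x)) + x) \<longlonglongrightarrow> 0 * t + x"
    by (intro tendsto_intros inv0 1)
  moreover have "eventually (\<lambda>n. 1 / sqrt (real n) * (sqrt (real n) * (real (k n) / real n - x)) + x = real (k n) / real n) sequentially"
    using eventually_gt_at_top[of 0] by eventually_elim auto
  ultimately show "(\<lambda>n. real (k n) / real n) \<longlonglongrightarrow> x" by (simp add: tendsto_cong)
qed

text \<open>The sum is an integral of a step function in \<open>t\<close>, where \<open>k = \<lfloor>n x + t \<surd>n\<rfloor>\<close>, to which dominated
  convergence applies. The factor \<open>Q\<close> expresses the second-order expansion of the exponent.\<close>

lemma laplace_window:
  fixes f \<phi> Q :: "real \<Rightarrow> real" and x a l :: real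
  assumes x: "0 < x" "x < 1" and a: "a > 0"
    and expansion: "\<And>y. f y + binary_entropy y = l + Q y * (y - x)\<^sup>2"
    and Q: "isCont Q x" "Q x = - a" and \<phi>: "isCont \<phi> x"
  shows "\<forall>\<^sub>F \<epsilon> in at_right 0.
    (\<lambda>n. \<Sum>k | k \<le> n \<and> \<bar>real k / real n - x\<bar> < \<epsilon>.
        \<phi> (real k / real n) * (real (n choose k) * exp (real n * (f (real k / real n) - l))))
    \<longlonglongrightarrow> \<phi> x * (exp (- lim stirling_error) * sqrt (pi / a) / sqrt (x * (1 - x)))"
proof -
  \<comment> \<open>This is |\<open>\<phi>\<close>| times the uniform bound on the scaled binomial
    coefficient.\<close>
  define \<psi> where "\<psi> y = \<bar>\<phi> y\<bar> * (1 / sqrt (y * (1 - y)))" for y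
  define M where "M = \<psi> x + 1"
  have "isCont \<psi> x" unfolding \<psi>_def using x by (intro continuous_intros \<phi>) auto
  then have "(\<psi> \<longlongrightarrow> \<psi> x) (nhds x)"
    by (simp only: isCont_def tendsto_at_iff_tendsto_nhds)
  then have "\<forall>\<^sub>F y in nhds x. \<psi> y < M"
    by (rule order_tendstoD) (simp add: M_def)
  moreover have "(Q \<longlongrightarrow> Q x) (nhds x)"
    using Q(1) by (simp only: isCont_def tendsto_at_iff_tendsto_nhds)
  \<comment> \<open>Giving up half of the curvature yields a Gaussian bound valid on a whole
    neighbourhood of x.\<close>
  then have "\<forall>\<^sub>F y in nhds x. Q y < - a / 2"
    by (rule order_tendstoD) (use Q a in simp)
  ultimately have "\<forall>\<^sub>F y in nhds x. \<psi> y < M \<and> Q y < - a / 2" by eventually_elim auto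
  then obtain d where d: "d > 0" "\<And>y. \<bar>y - x\<bar> < d \<Longrightarrow> \<psi> y < M \<and> Q y < - a / 2"
    by (auto simp: eventually_nhds_metric dist_real_def)
  \<comment> \<open>Below x and 1 - x, the window contains only k with 0 < k < n, where the Stirling
    identity holds; below d, both local bounds hold on it.\<close>
  define D where "D = Min {d, x, 1 - x}"
  have D: "D > 0" using d x by (simp add: D_def)
  have "\<forall>\<^sub>F \<epsilon> in at_right 0. \<epsilon> \<in> {0<..<D}"
    using D by (rule eventually_at_right_real)
  then show ?thesis
  proof eventually_elim
    case (elim \<epsilon>)
    then have \<epsilon>: "0 < \<epsilon>" "\<epsilon> < d" "\<epsilon> < x" "\<epsilon> < 1 - x" by (auto simp: D_def)
    define K where "K n = {k. k \<le> n \<and> \<bar>real k / real n - x\<bar> < \<epsilon>}" for n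
    have K: "finite (K n)" for n unfolding K_def by (rule finite_subset[of _ "{..n}"]) auto
    have Kb: "0 < k \<and> k < n" if "k \<in> K n" for k n
    proof -
      have "0 < real k / real n" "real k / real n < 1" using that \<epsilon> unfolding K_def by auto
      then show ?thesis by (auto simp: field_simps zero_less_divide_iff)
    qed
    define G where "G n k = (if k \<in> K n then \<phi> (real k / real n) *
        (sqrt (real n) * real (n choose k) * exp (- real n * binary_entropy (real k / real n))) *
        exp (Q (real k / real n) * (sqrt (real n) * (real k / real n - x))\<^sup>2) else 0)" for n k
    define \<Phi> where "\<Phi> n t = G n (nat \<lfloor>real n * x + sqrt (real n) * t\<rfloor>)" for n t
    have K0: "K 0 = {}" and z: "0 \<notin> K n" for n using Kb by blast+
    have meas: "\<Phi> n \<in> borel_measurable lborel" for n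
    \<comment> \<open>For n = 0 the scale sqrt n is 0, which the floor lemma excludes.\<close>
    proof (cases "n = 0")
      case True
      then have "\<Phi> n = (\<lambda>_. 0)" by (auto simp: \<Phi>_def G_def K0)
      then show ?thesis by simp
    next
      case False then show ?thesis unfolding \<Phi>_def
        by (intro sum_eq_integral_floor(1)[where K="K n"] K z) (auto simp: G_def)
    qed
    \<comment> \<open>The rate a/2 left by the bound on \<open>Q\<close> is halved again when the
      rounded point u is replaced by t, at the price of the factor exp(a/2).\<close>
    have bound: "norm (\<Phi> n t) \<le> M * exp (a / 2) * exp (- (a / 4) * t\<^sup>2)" for n t
    proof -
      define k where "k = nat \<lfloor>real n * x + sqrt (real n) * t\<rfloor>"
      have M: "M \<ge> 0" using x by (simp add: M_def \<psi>_def)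
      show ?thesis
      proof (cases "k \<in> K n")
        case False
        then show ?thesis using M by (simp add: \<Phi>_def G_def k_def[symmetric])
      next
        case True
        define y where "y = real k / real n"
        have k: "0 < k" "k < n" using Kb[OF True] by auto
        have y: "\<bar>y - x\<bar> < d" "0 < y" "y < 1" using True k \<epsilon> by (auto simp: K_def y_def)
        define u where "u = sqrt (real n) * (y - x)"
        have s: "sqrt (real n) \<ge> 1" "sqrt (real n) * sqrt (real n) = real n" using k by auto
        have "\<bar>real k - (real n * x + sqrt (real n) * t)\<bar> \<le> 1" using k(1) unfolding k_def by linarith
        moreover have "sqrt (real n) * (u - t) = real k - (real n * x + sqrt (real n) * t)"
        proof -
          have "sqrt (real n) * (u - t) = (sqrt (real n) * sqrt (real n)) * (y - x) - sqrt (real n) * t"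
            by (simp add: u_def algebra_simps)
          also have "\<dots> = real k - (real n * x + sqrt (real n) * t)"
            using k by (simp add: s(2) y_def algebra_simps)
          finally show ?thesis .
        qed
        ultimately have "sqrt (real n) * \<bar>u - t\<bar> \<le> 1" using s by (simp add: abs_mult_pos' flip: abs_mult)
        moreover have "1 * \<bar>u - t\<bar> \<le> sqrt (real n) * \<bar>u - t\<bar>" using s by (intro mult_right_mono) auto
        ultimately have ut: "\<bar>u - t\<bar> \<le> 1" by (metis mult_1 order_trans)
        have "Q y * u\<^sup>2 \<le> - (a / 2) * u\<^sup>2" using d(2)[OF y(1)] by (intro mult_right_mono) auto
        then have "exp (Q y * u\<^sup>2) \<le> exp (- (a / 2) * u\<^sup>2)" by simp
        also have "\<dots> \<le> exp (a / 2) * exp (- (a / 2 / 2) * t\<^sup>2)"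
          using a ut by (intro exp_neg_square_shift) auto
        finally have e: "exp (Q y * u\<^sup>2) \<le> exp (a / 2) * exp (- (a / 4) * t\<^sup>2)" by simp
        have "norm (\<Phi> n t) = (\<bar>\<phi> y\<bar> * (sqrt (real n) * real (n choose k) * exp (- real n * binary_entropy y)))
            * exp (Q y * u\<^sup>2)"
          using True by (simp add: \<Phi>_def G_def k_def[symmetric] y_def u_def abs_mult)
        also have "\<dots> \<le> (\<bar>\<phi> y\<bar> * (1 / sqrt (y * (1 - y)))) * exp (Q y * u\<^sup>2)"
          using binomial_entropy_bound[OF k] y unfolding y_def by (intro mult_mono mult_left_mono) auto
        also have "\<dots> \<le> M * (exp (a / 2) * exp (- (a / 4) * t\<^sup>2))"
          using d(2)[OF y(1)] e M by (intro mult_mono) (auto simp: \<psi>_def)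
        finally show ?thesis by simp
      qed
    qed
    have lim: "(\<lambda>n. \<Phi> n t) \<longlonglongrightarrow> \<phi> x * (exp (- lim stirling_error) / sqrt (x * (1 - x))) * exp (- a * t\<^sup>2)" for t
    proof -
      define k where "k n = nat \<lfloor>real n * x + sqrt (real n) * t\<rfloor>" for n
      have l1: "(\<lambda>n. sqrt (real n) * (real (k n) / real n - x)) \<longlonglongrightarrow> t"
        and l2: "(\<lambda>n. real (k n) / real n) \<longlonglongrightarrow> x"
        unfolding k_def using nat_floor_scaled_tendsto[OF x(1)] by auto
      have "(\<lambda>n. \<phi> (real (k n) / real n) *
        (sqrt (real n) * real (n choose k n) * exp (- real n * binary_entropy (real (k n) / real n))) *
        exp (Q (real (k n) / real n) * (sqrt (real n) * (real (k n) / real n - x))\<^sup>2))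
        \<longlonglongrightarrow> \<phi> x * (exp (- lim stirling_error) / sqrt (x * (1 - x))) * exp (Q x * t\<^sup>2)"
        by (intro tendsto_mult tendsto_exp tendsto_power l1 isCont_tendsto_compose[OF \<phi> l2]
          isCont_tendsto_compose[OF Q(1) l2] binomial_entropy_tendsto x l2)
      moreover have "\<forall>\<^sub>F n in sequentially. k n \<in> K n"
      proof -
        have "\<forall>\<^sub>F n in sequentially. x - \<epsilon> < real (k n) / real n \<and> real (k n) / real n < x + \<epsilon>
           \<and> real (k n) / real n < 1 \<and> n > 0"
          using \<epsilon> x by (intro eventually_conj order_tendstoD[OF l2] eventually_gt_at_top) auto
        then show ?thesis by eventually_elim (auto simp: K_def field_simps abs_less_iff)
      qed
      then have "\<forall>\<^sub>F n in sequentially. \<phi> (real (k n) / real n) *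
        (sqrt (real n) * real (n choose k n) * exp (- real n * binary_entropy (real (k n) / real n))) *
        exp (Q (real (k n) / real n) * (sqrt (real n) * (real (k n) / real n - x))\<^sup>2) = \<Phi> n t"
        by eventually_elim (simp add: \<Phi>_def G_def k_def[symmetric])
      ultimately show ?thesis unfolding Q(2) by (rule Lim_transform_eventually)
    qed
    have "(\<lambda>n. \<integral>t. \<Phi> n t \<partial>lborel) \<longlonglongrightarrow>
      (\<integral>t. \<phi> x * (exp (- lim stirling_error) / sqrt (x * (1 - x))) * exp (- a * t\<^sup>2) \<partial>lborel)"
      using bound lim a has_bochner_integral_exp_neg_square[of "a / 4"]
      by (intro integral_dominated_convergence[where w="\<lambda>t. M * exp (a / 2) * exp (- (a / 4) * t\<^sup>2)"] meas)
        (auto simp: has_bochner_integral_iff)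
    also have "(\<integral>t. \<phi> x * (exp (- lim stirling_error) / sqrt (x * (1 - x))) * exp (- a * t\<^sup>2) \<partial>lborel)
      = \<phi> x * (exp (- lim stirling_error) * sqrt (pi / a) / sqrt (x * (1 - x)))"
      using has_bochner_integral_exp_neg_square[OF a] by (simp add: has_bochner_integral_iff)
    finally have "(\<lambda>n. \<integral>t. \<Phi> n t \<partial>lborel) \<longlonglongrightarrow> \<phi> x * (exp (- lim stirling_error) * sqrt (pi / a) / sqrt (x * (1 - x)))" .
    moreover have "\<forall>\<^sub>F n in sequentially. (\<integral>t. \<Phi> n t \<partial>lborel) = (\<Sum>k\<in>K n. \<phi> (real k / real n) * (real (n choose k) * exp (real n * (f (real k / real n) - l))))"
      using eventually_gt_at_top[of 0]
    proof eventually_elim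
      case (elim n)
      have "(\<integral>t. \<Phi> n t \<partial>lborel) = (\<Sum>k\<in>K n. G n k) / sqrt (real n)"
        unfolding \<Phi>_def using elim by (intro sum_eq_integral_floor(2) K z) (auto simp: G_def)
      also have "\<dots> = (\<Sum>k\<in>K n. G n k / sqrt (real n))" by (rule sum_divide_distrib)
      also have "\<dots> = (\<Sum>k\<in>K n. \<phi> (real k / real n) * (real (n choose k) * exp (real n * (f (real k / real n) - l))))"
      proof (rule sum.cong)
        fix k assume k: "k \<in> K n"
        define y where "y = real k / real n"
        \<comment> \<open>The entropy part of the Gaussian exponent cancels against the entropy
          factor in \<open>G\<close>, and the 1 / sqrt n from the integral cancels the sqrt n
          there.\<close>
        have "Q y * (sqrt (real n) * (y - x))\<^sup>2 = real n * (f y - l) + real n * binary_entropy y"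
        proof -
          have "Q y * (sqrt (real n) * (y - x))\<^sup>2 = real n * (Q y * (y - x)\<^sup>2)"
            by (simp add: power_mult_distrib)
          also have "Q y * (y - x)\<^sup>2 = f y - l + binary_entropy y" using expansion[of y] by simp
          finally show ?thesis by (simp add: algebra_simps)
        qed
        then have "exp (- real n * binary_entropy y) * exp (Q y * (sqrt (real n) * (y - x))\<^sup>2) = exp (real n * (f y - l))"
          by (simp flip: exp_add)
        then show "G n k / sqrt (real n) = \<phi> (real k / real n) * (real (n choose k) * exp (real n * (f (real k / real n) - l)))"
          using k elim by (simp add: G_def y_def)
      qed simp
      finally show ?case .
    qed
    ultimately show ?case unfolding K_def by (rule Lim_transform_eventually)
  qed
qed

section \<open>Concentration at one or two maximizers\<close>

text \<open>Only the point 0 needs an argument: with u = 1/x the function is -(ln u) / u, and u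
  tends to infinity.\<close>

lemma continuous_on_mult_ln: "continuous_on {0..} (\<lambda>x::real. x * ln x)"
proof -
  have "((\<lambda>x::real. - (ln (inverse x) / inverse x)) \<longlongrightarrow> - 0) (at_right 0)"
    by (intro tendsto_minus filterlim_compose[OF ln_x_over_x_tendsto_0 filterlim_inverse_at_top_right])
  moreover have "\<forall>\<^sub>F x::real in at_right 0. - (ln (inverse x) / inverse x) = x * ln x"
    unfolding eventually_at_right_field by (auto simp: ln_inverse divide_inverse intro!: exI[of _ 1])
  ultimately have 0: "((\<lambda>x::real. x * ln x) \<longlongrightarrow> 0) (at_right 0)"
    unfolding minus_zero by (rule Lim_transform_eventually)
  show ?thesis
    unfolding continuous_on_def
  proof
    fix x :: real assume "x \<in> {0..}"
    show "((\<lambda>x. x * ln x) \<longlongrightarrow> x * ln x) (at x within {0..})"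
    proof (cases "x = 0")
      case True
      then show ?thesis using 0 by (simp add: at_within_Ici_at_right)
    next
      case False
      then show ?thesis using \<open>x \<in> {0..}\<close>
        by (intro tendsto_intros) auto
    qed
  qed
qed

lemma continuous_on_binary_entropy: "continuous_on {0..1} binary_entropy"
proof -
  have "continuous_on {0..1} (\<lambda>x::real. x * ln x)"
    by (rule continuous_on_subset[OF continuous_on_mult_ln]) auto
  moreover have "continuous_on {0..1} (\<lambda>x::real. (1 - x) * ln (1 - x))"
    by (rule continuous_on_compose2[OF continuous_on_mult_ln, of _ "\<lambda>x. 1 - x"])
      (auto intro!: continuous_intros)
  ultimately have "continuous_on {0..1} (\<lambda>x::real. - (x * ln x) - (1 - x) * ln (1 - x))"
    by (intro continuous_on_diff continuous_on_minus)
  then show ?thesis by (simp add: binary_entropy_def[abs_def])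
qed

section \<open>Normalized weights and exponential rates\<close>

definition binomial_weight :: "(real \<Rightarrow> real) \<Rightarrow> real \<Rightarrow> nat \<Rightarrow> nat \<Rightarrow> real" where
  "binomial_weight f l n k = real (n choose k) * exp (real n * (f (real k / real n) - l))"

lemma binomial_weight_nonneg: "binomial_weight f l n k \<ge> 0"
  by (simp add: binomial_weight_def)

lemma binomial_weight_shift: "binomial_weight f l n k = exp (- real n * l) * binomial_weight f 0 n k"
  by (simp add: binomial_weight_def algebra_simps flip: exp_add)

text \<open>This leaves the choice of the normalizing level \<open>l\<close> open, to be made
  separately for each kind of maximizer.\<close>

lemma binomial_weight_ratio_shift:
  "(\<Sum>k\<le>n. g k * binomial_weight f 0 n k) / (\<Sum>k\<le>n. binomial_weight f 0 n k) =
   (\<Sum>k\<le>n. g k * binomial_weight f l n k) / (\<Sum>k\<le>n. binomial_weight f l n k)"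
proof -
  have "(\<Sum>k\<le>n. g k * binomial_weight f l n k) = exp (- real n * l) * (\<Sum>k\<le>n. g k * binomial_weight f 0 n k)"
    unfolding binomial_weight_shift[of f l] by (simp add: sum_distrib_left mult.left_commute)
  moreover have "(\<Sum>k\<le>n. binomial_weight f l n k) = exp (- real n * l) * (\<Sum>k\<le>n. binomial_weight f 0 n k)"
    unfolding binomial_weight_shift[of f l] by (simp add: sum_distrib_left)
  ultimately show ?thesis by simp
qed

text \<open>Compactness turns the pointwise strict inequality into a uniform gap
  \<open>\<delta>\<close>. Each of the at most n + 1 terms is then at most
  \<open>M * exp (- \<delta>) ^ n\<close>.\<close>

lemma tail_negligible:
  fixes f \<phi> :: "real \<Rightarrow> real" and T :: "real set"
  assumes T: "compact T" "T \<subseteq> {0..1}"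
    and cont: "continuous_on {0..1} f"
    and less: "\<And>y. y \<in> T \<Longrightarrow> f y + binary_entropy y < l"
    and \<phi>: "\<And>y. y \<in> T \<Longrightarrow> \<bar>\<phi> y\<bar> \<le> M"
  shows "(\<lambda>n. \<Sum>k | k \<le> n \<and> real k / real n \<in> T. \<phi> (real k / real n) * binomial_weight f l n k) \<longlonglongrightarrow> 0"
proof (cases "T = {}")
  case True then show ?thesis by simp
next
  case False
  have "continuous_on T (\<lambda>y. f y + binary_entropy y)"
    using T by (intro continuous_intros continuous_on_subset[OF cont] continuous_on_subset[OF continuous_on_binary_entropy])
  from continuous_attains_sup[OF T(1) False this] obtain z where
    z: "z \<in> T" "\<And>y. y \<in> T \<Longrightarrow> f y + binary_entropy y \<le> f z + binary_entropy z" by blast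
  define \<delta> where "\<delta> = l - (f z + binary_entropy z)"
  have \<delta>: "\<delta> > 0" "\<And>y. y \<in> T \<Longrightarrow> f y + binary_entropy y \<le> l - \<delta>"
    using z less by (auto simp: \<delta>_def)
  have M: "M \<ge> 0" using \<phi>[OF z(1)] by linarith
  show ?thesis
  proof (rule Lim_null_comparison)
    show "\<forall>\<^sub>F n in sequentially. norm (\<Sum>k | k \<le> n \<and> real k / real n \<in> T. \<phi> (real k / real n) * binomial_weight f l n k)
      \<le> real (n + 1) * (M * exp (- \<delta>) ^ n)"
      using eventually_gt_at_top[of 0]
    proof eventually_elim
      case (elim n)
      have term_le: "norm (\<phi> (real k / real n) * binomial_weight f l n k) \<le> M * exp (- \<delta>) ^ n"
        if k: "k \<le> n" "real k / real n \<in> T" for k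
      proof -
        define y where "y = real k / real n"
        have "binomial_weight f l n k \<le> exp (real n * binary_entropy y) * exp (real n * (f y - l))"
          unfolding binomial_weight_def y_def using binomial_le_exp_entropy k elim by (intro mult_right_mono) auto
        also have "\<dots> = exp (real n * (f y + binary_entropy y - l))"
          by (simp add: algebra_simps flip: exp_add)
        also have "\<dots> \<le> exp (real n * (- \<delta>))"
          unfolding exp_le_cancel_iff using \<delta>(2)[of y] k by (intro mult_left_mono) (auto simp: y_def)
        also have "\<dots> = exp (- \<delta>) ^ n" by (rule exp_of_nat_mult)
        finally show ?thesis
          unfolding norm_mult using \<phi> k M by (intro mult_mono) (auto simp: binomial_weight_nonneg)
      qed
      have "norm (\<Sum>k | k \<le> n \<and> real k / real n \<in> T. \<phi> (real k / real n) * binomial_weight f l n k)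
        \<le> (\<Sum>k | k \<le> n \<and> real k / real n \<in> T. M * exp (- \<delta>) ^ n)"
        by (intro sum_norm_le term_le) auto
      also have "\<dots> \<le> (\<Sum>k\<in>{..n}. M * exp (- \<delta>) ^ n)"
        using M by (intro sum_mono2) auto
      finally show ?case by simp
    qed
    have "(\<lambda>n. real n * exp (- \<delta>) ^ n) \<longlonglongrightarrow> 0" "(\<lambda>n. exp (- \<delta>) ^ n) \<longlonglongrightarrow> 0"
      using \<delta> by (auto intro!: powser_times_n_limit_0 LIMSEQ_power_zero)
    then have "(\<lambda>n. M * (real n * exp (- \<delta>) ^ n + exp (- \<delta>) ^ n)) \<longlonglongrightarrow> M * (0 + 0)"
      by (intro tendsto_mult tendsto_add tendsto_const)
    then show "(\<lambda>n. real (n + 1) * (M * exp (- \<delta>) ^ n)) \<longlonglongrightarrow> 0" by (simp add: algebra_simps)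
  qed
qed

text \<open>The single term at k = floor(n x) suffices: by Stirling it is of order exp(n (L - l)) /
  sqrt n with L - l eventually above a positive constant. The bound 1 is all that a later division
  requires.\<close>

lemma total_binomial_weight_diverges:
  fixes f :: "real \<Rightarrow> real"
  assumes x: "0 < x" "x < 1" and cont: "continuous_on {0..1} f" and less: "l < f x + binary_entropy x"
  shows "\<forall>\<^sub>F n in sequentially. 1 \<le> (\<Sum>k\<le>n. binomial_weight f l n k)"
proof -
  define L where "L y = f y + binary_entropy y" for y
  define \<eta> where "\<eta> = (L x - l) / 2"
  have \<eta>: "\<eta> > 0" "l + \<eta> < L x" using less by (auto simp: \<eta>_def L_def field_simps)
  define k where "k n = nat \<lfloor>real n * x\<rfloor>" for n
  have lim: "(\<lambda>n. real (k n) / real n) \<longlonglongrightarrow> x"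
    using nat_floor_scaled_tendsto(2)[OF x(1), of 0] by (simp add: k_def)
  define b where "b n = sqrt (real n) * real (n choose k n) * exp (- real n * binary_entropy (real (k n) / real n))" for n
  have b: "b \<longlonglongrightarrow> exp (- lim stirling_error) / sqrt (x * (1 - x))"
    unfolding b_def using binomial_entropy_tendsto[OF x lim] .
  have kn: "k n \<le> n" for n
  proof -
    have "real n * x \<le> real n" using x by (simp add: mult_left_le)
    then show ?thesis by (simp add: k_def nat_le_iff floor_le_iff)
  qed
  have "isCont L x" unfolding L_def using x
    by (intro continuous_intros continuous_on_interior[OF cont] continuous_on_interior[OF continuous_on_binary_entropy])
      (auto simp: interior_atLeastAtMost_real)
  then have "(\<lambda>n. L (real (k n) / real n)) \<longlonglongrightarrow> L x" by (rule isCont_tendsto_compose[OF _ lim])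
  then have ev1: "\<forall>\<^sub>F n in sequentially. l + \<eta> < L (real (k n) / real n)"
    using \<eta>(2) by (rule order_tendstoD)
  have "filterlim (\<lambda>n. b n * (sqrt (real n) * \<eta>)) at_top sequentially"
    using x \<eta> by (intro filterlim_tendsto_pos_mult_at_top[OF b]
      filterlim_at_top_mult_tendsto_pos[OF tendsto_const] filterlim_compose[OF sqrt_at_top filterlim_real_sequentially]) auto
  then have ev2: "\<forall>\<^sub>F n in sequentially. 1 \<le> b n * (sqrt (real n) * \<eta>)" by (auto simp: filterlim_at_top)
  show ?thesis using ev1 ev2 eventually_gt_at_top[of 0]
  proof eventually_elim
    case (elim n)
    define y where "y = real (k n) / real n"
    have s: "sqrt (real n) * sqrt (real n) = real n" "sqrt (real n) > 0" using elim by auto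
    \<comment> \<open>The estimate exp u >= u is strong enough here, as linear growth already beats
      1 / sqrt n.\<close>
    have "sqrt (real n) * \<eta> = real n / sqrt (real n) * \<eta>" by (simp only: real_div_sqrt of_nat_0_le_iff)
    also have "\<dots> = real n * \<eta> / sqrt (real n)" by simp
    also have "\<dots> \<le> exp (real n * (L y - l)) / sqrt (real n)"
    proof (intro divide_right_mono)
      have "real n * \<eta> \<le> real n * (L y - l)" using elim by (intro mult_left_mono) (auto simp: y_def)
      also have "\<dots> \<le> exp (real n * (L y - l))" using exp_ge_add_one_self[of "real n * (L y - l)"] by linarith
      finally show "real n * \<eta> \<le> exp (real n * (L y - l))" .
    qed auto
    finally have "b n * (sqrt (real n) * \<eta>) \<le> b n * (exp (real n * (L y - l)) / sqrt (real n))"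
      by (intro mult_left_mono) (auto simp: b_def)
    also have "\<dots> = binomial_weight f l n (k n)"
      using s by (simp add: b_def L_def binomial_weight_def y_def[symmetric] algebra_simps flip: exp_add)
    also have "\<dots> \<le> (\<Sum>k\<le>n. binomial_weight f l n k)"
      using kn by (intro member_le_sum) (auto simp: binomial_weight_nonneg)
    finally show ?case using elim by linarith
  qed
qed

text \<open>Strictness of the maximum is the only local information, so a degenerate maximum, as at
  the critical point, is covered.\<close>

lemma binomial_weight_concentration:
  fixes f :: "real \<Rightarrow> real"
  assumes x: "0 < x" "x < 1" and cont: "continuous_on {0..1} f"
    and max: "\<And>y. y \<in> {0..1} \<Longrightarrow> y \<noteq> x \<Longrightarrow> f y + binary_entropy y < f x + binary_entropy x"
  shows "(\<lambda>n. (\<Sum>k\<le>n. real k / real n * binomial_weight f 0 n k) / (\<Sum>k\<le>n. binomial_weight f 0 n k)) \<longlonglongrightarrow> x"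
proof (rule tendstoI)
  fix e :: real assume "e > 0"
  \<comment> \<open>The bound x/2 keeps 0 in the set \<open>T\<close> below, so that the supremum
    over \<open>T\<close> is attained; e/2 leaves half of the tolerance to the tail.\<close>
  define \<epsilon> where "\<epsilon> = min (e / 2) (x / 2)"
  have \<epsilon>: "\<epsilon> > 0" "\<epsilon> \<le> e / 2" "\<epsilon> \<le> x" using \<open>e > 0\<close> x by (auto simp: \<epsilon>_def)
  define T where "T = {0..x - \<epsilon>} \<union> {x + \<epsilon>..1}"
  have T: "compact T" "T \<subseteq> {0..1}" using \<epsilon> x by (auto simp: T_def)
  have T0: "0 \<in> T" using \<epsilon> by (auto simp: T_def)
  have "continuous_on T (\<lambda>y. f y + binary_entropy y)"
    using T by (intro continuous_intros continuous_on_subset[OF cont] continuous_on_subset[OF continuous_on_binary_entropy])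
  from continuous_attains_sup[OF T(1) _ this] T0 obtain z where
    z: "z \<in> T" "\<And>y. y \<in> T \<Longrightarrow> f y + binary_entropy y \<le> f z + binary_entropy z" by blast
  have "z \<noteq> x" using z \<epsilon> by (auto simp: T_def)
  then have "f z + binary_entropy z < f x + binary_entropy x" using max z T by blast
  \<comment> \<open>A level strictly between the two rates makes the weight of \<open>T\<close>
    vanish and keeps the total at least 1.\<close>
  then obtain l where l: "f z + binary_entropy z < l" "l < f x + binary_entropy x" using dense by blast
  define w where "w = binomial_weight f l"
  define R where "R n = (\<Sum>k | k \<le> n \<and> real k / real n \<in> T. w n k)" for n
  have "(\<lambda>n. \<Sum>k | k \<le> n \<and> real k / real n \<in> T. (\<lambda>_. 1) (real k / real n) * binomial_weight f l n k) \<longlonglongrightarrow> 0"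
    using z l by (intro tail_negligible[where M=1] T cont) (auto intro: le_less_trans)
  then have "R \<longlonglongrightarrow> 0" by (simp add: R_def[abs_def] w_def)
  then have ev: "\<forall>\<^sub>F n in sequentially. R n < e / 2" using \<open>e > 0\<close> by (intro order_tendstoD) auto
  have "\<forall>\<^sub>F n in sequentially. 1 \<le> (\<Sum>k\<le>n. w n k)"
    unfolding w_def by (rule total_binomial_weight_diverges[OF x cont l(2)])
  then show "\<forall>\<^sub>F n in sequentially. dist ((\<Sum>k\<le>n. real k / real n * binomial_weight f 0 n k) / (\<Sum>k\<le>n. binomial_weight f 0 n k)) x < e"
    using ev eventually_gt_at_top[of 0]
  proof eventually_elim
    case (elim n)
    define W where "W = (\<Sum>k\<le>n. w n k)"
    have W: "W \<ge> 1" using elim by (simp add: W_def)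
    have w0: "w n k \<ge> 0" for k by (simp add: w_def binomial_weight_nonneg)
    have "(\<Sum>k\<le>n. real k / real n * w n k) - x * W = (\<Sum>k\<le>n. (real k / real n - x) * w n k)"
      by (simp add: W_def sum_distrib_left sum_subtractf algebra_simps)
    also have "\<bar>\<dots>\<bar> \<le> (\<Sum>k\<le>n. \<bar>(real k / real n - x) * w n k\<bar>)" by (rule sum_abs)
    \<comment> \<open>Near x the distance is at most \<open>\<epsilon>\<close>; on \<open>T\<close>
      it is at most 1, as both points lie in the unit interval.\<close>
    also have "\<dots> \<le> (\<Sum>k\<le>n. \<epsilon> * w n k + (if real k / real n \<in> T then w n k else 0))"
    proof (rule sum_mono)
      fix k assume "k \<in> {..n}"
      then have y: "0 \<le> real k / real n" "real k / real n \<le> 1" using elim by auto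
      show "\<bar>(real k / real n - x) * w n k\<bar> \<le> \<epsilon> * w n k + (if real k / real n \<in> T then w n k else 0)"
      proof (cases "real k / real n \<in> T")
        case True
        have "\<bar>real k / real n - x\<bar> \<le> 1" using y x by linarith
        then have "\<bar>real k / real n - x\<bar> * w n k \<le> 1 * w n k" using w0 by (intro mult_right_mono)
        then show ?thesis using True w0[of k] \<epsilon> by (simp add: abs_mult add_increasing)
      next
        case False
        then have "\<bar>real k / real n - x\<bar> \<le> \<epsilon>" using y by (auto simp: T_def)
        then show ?thesis using False w0[of k] by (simp add: abs_mult mult_right_mono)
      qed
    qed
    also have "\<dots> = \<epsilon> * W + R n"
      by (simp add: sum.distrib W_def R_def sum_distrib_left sum.If_cases Int_def)
    also have "\<dots> < e / 2 * W + e / 2 * W"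
    proof (rule add_le_less_mono)
      show "\<epsilon> * W \<le> e / 2 * W" using \<epsilon> W by (intro mult_right_mono) auto
      have "e / 2 * 1 \<le> e / 2 * W" using \<open>e > 0\<close> W by (intro mult_left_mono) auto
      then show "R n < e / 2 * W" using elim by linarith
    qed
    also have "e / 2 * W + e / 2 * W = e * W" by (simp add: field_simps)
    finally have "\<bar>(\<Sum>k\<le>n. real k / real n * w n k) - x * W\<bar> < e * W" .
    moreover have "(\<Sum>k\<le>n. real k / real n * w n k) / W - x = ((\<Sum>k\<le>n. real k / real n * w n k) - x * W) / W"
      using W by (simp add: field_simps)
    ultimately have "\<bar>(\<Sum>k\<le>n. real k / real n * w n k) / W - x\<bar> < e"
      using W by (simp add: abs_divide pos_divide_less_eq)
    then show ?case
      unfolding binomial_weight_ratio_shift[where l=l] dist_real_def W_def w_def .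
  qed
qed

text \<open>Each maximizer contributes through its own small window, and what remains is a compact
  set on which the exponent stays below \<open>l\<close>.\<close>

lemma laplace_two_points:
  fixes f \<phi> Q R :: "real \<Rightarrow> real"
  assumes x: "0 < x1" "x1 < x2" "x2 < 1" and a: "a1 > 0" "a2 > 0"
    and cont: "continuous_on {0..1} f"
    and max: "\<And>y. y \<in> {0..1} \<Longrightarrow> y \<noteq> x1 \<Longrightarrow> y \<noteq> x2 \<Longrightarrow> f y + binary_entropy y < l"
    and expansion1: "\<And>y. f y + binary_entropy y = l + Q y * (y - x1)\<^sup>2"
    and Q: "isCont Q x1" "Q x1 = - a1"
    and expansion2: "\<And>y. f y + binary_entropy y = l + R y * (y - x2)\<^sup>2"
    and R: "isCont R x2" "R x2 = - a2"
    and \<phi>: "isCont \<phi> x1" "isCont \<phi> x2" "\<And>y. y \<in> {0..1} \<Longrightarrow> \<bar>\<phi> y\<bar> \<le> M"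
  defines "C \<equiv> \<lambda>x a. exp (- lim stirling_error) * sqrt (pi / a) / sqrt (x * (1 - x))"
  shows "(\<lambda>n. \<Sum>k\<le>n. \<phi> (real k / real n) * binomial_weight f l n k) \<longlonglongrightarrow> \<phi> x1 * C x1 a1 + \<phi> x2 * C x2 a2"
proof -
  define S where "S P n = (\<Sum>k | k \<le> n \<and> P (real k / real n). \<phi> (real k / real n) * binomial_weight f l n k)" for P n
  have "\<forall>\<^sub>F \<epsilon> in at_right 0. S (\<lambda>y. \<bar>y - x1\<bar> < \<epsilon>) \<longlonglongrightarrow> \<phi> x1 * C x1 a1"
    unfolding S_def C_def binomial_weight_def using x
    by (intro laplace_window[where Q=Q] a expansion1 Q \<phi>) auto
  moreover have "\<forall>\<^sub>F \<epsilon> in at_right 0. S (\<lambda>y. \<bar>y - x2\<bar> < \<epsilon>) \<longlonglongrightarrow> \<phi> x2 * C x2 a2"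
    unfolding S_def C_def binomial_weight_def using x
    by (intro laplace_window[where Q=R] a expansion2 R \<phi>) auto
  \<comment> \<open>Below half the distance the two windows are disjoint. That the window limits
    hold for all small radii is what allows a common radius.\<close>
  moreover have "\<forall>\<^sub>F \<epsilon> in at_right 0. \<epsilon> \<in> {0<..<(x2 - x1) / 2}"
    using x by (intro eventually_at_right_real) auto
  ultimately have "\<forall>\<^sub>F \<epsilon> in at_right 0. \<epsilon> \<in> {0<..<(x2 - x1) / 2} \<and>
    S (\<lambda>y. \<bar>y - x1\<bar> < \<epsilon>) \<longlonglongrightarrow> \<phi> x1 * C x1 a1 \<and> S (\<lambda>y. \<bar>y - x2\<bar> < \<epsilon>) \<longlonglongrightarrow> \<phi> x2 * C x2 a2"
    by eventually_elim auto
  then obtain \<epsilon> where \<epsilon>: "0 < \<epsilon>" "\<epsilon> < (x2 - x1) / 2"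
    and lim1: "S (\<lambda>y. \<bar>y - x1\<bar> < \<epsilon>) \<longlonglongrightarrow> \<phi> x1 * C x1 a1"
    and lim2: "S (\<lambda>y. \<bar>y - x2\<bar> < \<epsilon>) \<longlonglongrightarrow> \<phi> x2 * C x2 a2"
    using eventually_happens'[OF trivial_limit_at_right_real] by (metis (no_types, lifting) greaterThanLessThan_iff)
  \<comment> \<open>Removing open balls keeps the remainder compact.\<close>
  define T where "T = {0..1} - ball x1 \<epsilon> - ball x2 \<epsilon>"
  have "compact T" unfolding T_def by (intro compact_diff) auto
  moreover have "f y + binary_entropy y < l" if "y \<in> T" for y
    using that \<epsilon> by (intro max) (auto simp: T_def)
  ultimately have lim3: "S (\<lambda>y. y \<in> T) \<longlonglongrightarrow> 0"
    unfolding S_def using \<phi>(3) by (intro tail_negligible[where M=M] cont) (auto simp: T_def)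
  have "(\<lambda>n. S (\<lambda>y. \<bar>y - x1\<bar> < \<epsilon>) n + S (\<lambda>y. \<bar>y - x2\<bar> < \<epsilon>) n + S (\<lambda>y. y \<in> T) n)
      \<longlonglongrightarrow> \<phi> x1 * C x1 a1 + \<phi> x2 * C x2 a2 + 0"
    by (intro tendsto_add lim1 lim2 lim3)
  moreover have "\<forall>\<^sub>F n in sequentially. S (\<lambda>y. \<bar>y - x1\<bar> < \<epsilon>) n + S (\<lambda>y. \<bar>y - x2\<bar> < \<epsilon>) n + S (\<lambda>y. y \<in> T) n =
    (\<Sum>k\<le>n. \<phi> (real k / real n) * binomial_weight f l n k)"
    using eventually_gt_at_top[of 0]
  proof eventually_elim
    case (elim n)
    let ?A = "\<lambda>P. {k. k \<le> n \<and> P (real k / real n)}"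
    have fin: "finite (?A P)" for P by (rule finite_subset[of _ "{..n}"]) auto
    have "{..n} = ?A (\<lambda>y. \<bar>y - x1\<bar> < \<epsilon>) \<union> ?A (\<lambda>y. \<bar>y - x2\<bar> < \<epsilon>) \<union> ?A (\<lambda>y. y \<in> T)"
      using elim by (auto simp: T_def dist_real_def abs_minus_commute)
    moreover have "?A (\<lambda>y. \<bar>y - x1\<bar> < \<epsilon>) \<inter> ?A (\<lambda>y. \<bar>y - x2\<bar> < \<epsilon>) = {}"
      using \<epsilon> by auto
    moreover have "(?A (\<lambda>y. \<bar>y - x1\<bar> < \<epsilon>) \<union> ?A (\<lambda>y. \<bar>y - x2\<bar> < \<epsilon>)) \<inter> ?A (\<lambda>y. y \<in> T) = {}"
      by (auto simp: T_def dist_real_def abs_minus_commute)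
    ultimately show ?case
      unfolding S_def using fin by (simp add: sum.union_disjoint)
  qed
  ultimately show ?thesis
    unfolding add_0_right by (rule Lim_transform_eventually)
qed

section \<open>Factorization over rows\<close>

text \<open>Bit vectors are indicators of subsets of \<open>J\<close>; grouping the subsets by size
  gives the binomial coefficients.\<close>

lemma sum_PiE_binary:
  fixes h :: "real \<Rightarrow> real"
  assumes "finite J"
  shows "(\<Sum>r\<in>J \<rightarrow>\<^sub>E {0, 1}. h (\<Sum>j\<in>J. r j)) = (\<Sum>k\<le>card J. real (card J choose k) * h (real k))"
proof -
  have "(\<Sum>r\<in>J \<rightarrow>\<^sub>E {0, 1}. h (\<Sum>j\<in>J. r j)) = (\<Sum>A\<in>Pow J. h (real (card A)))"
  proof (rule sum.reindex_bij_witness[where i = "\<lambda>A. restrict (indicator A) J" and j = "\<lambda>r. {j\<in>J. r j = 1}"])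
    fix r assume r: "r \<in> J \<rightarrow>\<^sub>E {0, 1::real}"
    then have *: "r j = 0 \<or> r j = 1" if "j \<in> J" for j using that by (auto dest: PiE_mem)
    show "restrict (indicator {j \<in> J. r j = 1}) J = r"
    proof
      fix j show "restrict (indicator {j \<in> J. r j = 1}) J j = r j"
      proof (cases "j \<in> J")
        case True
        then show ?thesis using *[OF True] by (auto simp: indicator_def)
      next
        case False
        then show ?thesis using PiE_arb[OF r False] by simp
      qed
    qed
    have "(\<Sum>j\<in>J. r j) = (\<Sum>j\<in>J. if r j = 1 then 1 else 0)"
      using * by (intro sum.cong) auto
    also have "\<dots> = real (card {j \<in> J. r j = 1})"
      using assms by (simp add: sum.If_cases Int_def)
    finally show "h (real (card {j \<in> J. r j = 1})) = h (\<Sum>j\<in>J. r j)" by simp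
  qed (auto simp: indicator_def)
  also have "\<dots> = (\<Sum>k\<le>card J. \<Sum>A | A \<in> Pow J \<and> card A = k. h (real (card A)))"
    using assms by (intro sum.group[symmetric]) (auto intro: card_mono)
  also have "\<dots> = (\<Sum>k\<le>card J. real (card J choose k) * h (real k))"
  proof (rule sum.cong)
    fix k
    have "(\<Sum>A | A \<in> Pow J \<and> card A = k. h (real (card A))) = real (card {A. A \<subseteq> J \<and> card A = k}) * h (real k)"
      by simp
    then show "(\<Sum>A | A \<in> Pow J \<and> card A = k. h (real (card A))) = real (card J choose k) * h (real k)"
      using n_subsets[OF assms] by simp
  qed simp
  finally show ?thesis .
qed

text \<open>Composition with the transposition of a and b is an involution on bit vectors that
  preserves the total.\<close>

lemma sum_PiE_coordinate_exchange:
  fixes h :: "real \<Rightarrow> real"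
  assumes "a \<in> J" "b \<in> J"
  shows "(\<Sum>r\<in>J \<rightarrow>\<^sub>E {0, 1}. r a * h (\<Sum>j\<in>J. r j)) = (\<Sum>r\<in>J \<rightarrow>\<^sub>E {0, 1}. r b * h (\<Sum>j\<in>J. r j))"
proof (rule sum.reindex_bij_witness[where i = "\<lambda>r. r \<circ> Transposition.transpose a b" and j = "\<lambda>r. r \<circ> Transposition.transpose a b"])
  have perm: "bij_betw (Transposition.transpose a b) J J"
    using assms by (metis bij_betw_def inj_on_transpose transpose_image_eq)
  then have mem: "Transposition.transpose a b j \<in> J \<longleftrightarrow> j \<in> J" for j
    using assms by (auto simp: Transposition.transpose_def)
  fix r assume "r \<in> J \<rightarrow>\<^sub>E {0, 1::real}"
  then show "r \<circ> Transposition.transpose a b \<in> J \<rightarrow>\<^sub>E {0, 1}" "r \<circ> Transposition.transpose a b \<in> J \<rightarrow>\<^sub>E {0, 1}"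
    by (auto simp: PiE_iff extensional_def mem)
  have "(\<Sum>j\<in>J. (r \<circ> Transposition.transpose a b) j) = (\<Sum>j\<in>J. r j)"
    using sum.reindex_bij_betw[OF perm, of r] by simp
  then show "(r \<circ> Transposition.transpose a b) b * h (\<Sum>j\<in>J. (r \<circ> Transposition.transpose a b) j) = r a * h (\<Sum>j\<in>J. r j)"
    by simp
qed (auto simp: comp_assoc)

text \<open>By exchangeability the sum is the same for every coordinate. Averaging over
  \<open>J\<close> replaces the single bit by the mean k / card J.\<close>

lemma sum_PiE_binary_coordinate:
  fixes h :: "real \<Rightarrow> real"
  assumes "finite J" "a \<in> J"
  shows "(\<Sum>r\<in>J \<rightarrow>\<^sub>E {0, 1}. r a * h (\<Sum>j\<in>J. r j)) =
    (\<Sum>k\<le>card J. real k / real (card J) * (real (card J choose k) * h (real k)))"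
proof -
  let ?S = "\<lambda>b. \<Sum>r\<in>J \<rightarrow>\<^sub>E {0, 1}. r b * h (\<Sum>j\<in>J. r j)"
  have "real (card J) * ?S a = (\<Sum>b\<in>J. ?S a)" by simp
  also have "\<dots> = (\<Sum>b\<in>J. ?S b)"
    by (rule sum.cong[OF refl sum_PiE_coordinate_exchange[OF assms(2)]])
  also have "\<dots> = (\<Sum>r\<in>J \<rightarrow>\<^sub>E {0, 1}. (\<lambda>s. s * h s) (\<Sum>j\<in>J. r j))"
    by (subst sum.swap) (simp add: sum_distrib_right)
  also have "\<dots> = (\<Sum>k\<le>card J. real (card J choose k) * (real k * h (real k)))"
    by (rule sum_PiE_binary[OF assms(1)])
  finally have "real (card J) * ?S a = (\<Sum>k\<le>card J. real (card J choose k) * (real k * h (real k)))" .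
  moreover have "real (card J) > 0" using assms card_gt_0_iff by fastforce
  ultimately have "?S a = (\<Sum>k\<le>card J. real (card J choose k) * (real k * h (real k))) / real (card J)"
    by (simp add: field_simps)
  then show ?thesis by (simp add: sum_divide_distrib mult_ac)
qed

text \<open>Currying identifies a matrix with its family of rows, and a product of sums expands over
  such families. The restrictions keep both sides extensional.\<close>

lemma sum_PiE_rows:
  fixes g :: "'i \<Rightarrow> ('j \<Rightarrow> 'b) \<Rightarrow> real"
  assumes "finite I" "finite J" "finite S"
  shows "(\<Sum>X\<in>I \<times> J \<rightarrow>\<^sub>E S. \<Prod>i\<in>I. g i (\<lambda>j\<in>J. X (i, j))) = (\<Prod>i\<in>I. \<Sum>r\<in>J \<rightarrow>\<^sub>E S. g i r)"
proof -
  have "(\<Sum>X\<in>I \<times> J \<rightarrow>\<^sub>E S. \<Prod>i\<in>I. g i (\<lambda>j\<in>J. X (i, j))) = (\<Sum>Y\<in>I \<rightarrow>\<^sub>E (J \<rightarrow>\<^sub>E S). \<Prod>i\<in>I. g i (Y i))"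
  proof (rule sum.reindex_bij_witness[where i = "\<lambda>Y. \<lambda>(i, j)\<in>I \<times> J. Y i j" and j = "\<lambda>X. \<lambda>i\<in>I. \<lambda>j\<in>J. X (i, j)"])
    fix X assume X: "X \<in> I \<times> J \<rightarrow>\<^sub>E S"
    show "(\<lambda>(i, j)\<in>I \<times> J. (\<lambda>i\<in>I. \<lambda>j\<in>J. X (i, j)) i j) = X"
    proof
      fix z show "(\<lambda>(i, j)\<in>I \<times> J. (\<lambda>i\<in>I. \<lambda>j\<in>J. X (i, j)) i j) z = X z"
        using PiE_arb[OF X, of z] by (cases z) auto
    qed
    show "(\<lambda>i\<in>I. \<lambda>j\<in>J. X (i, j)) \<in> I \<rightarrow>\<^sub>E (J \<rightarrow>\<^sub>E S)" using X by auto
    show "(\<Prod>i\<in>I. g i ((\<lambda>i\<in>I. \<lambda>j\<in>J. X (i, j)) i)) = (\<Prod>i\<in>I. g i (\<lambda>j\<in>J. X (i, j)))"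
      by (rule prod.cong) auto
  next
    fix Y assume Y: "Y \<in> I \<rightarrow>\<^sub>E (J \<rightarrow>\<^sub>E S)"
    then have mem: "Y i \<in> J \<rightarrow>\<^sub>E S" if "i \<in> I" for i using that by (rule PiE_mem)
    show "(\<lambda>(i, j)\<in>I \<times> J. Y i j) \<in> I \<times> J \<rightarrow>\<^sub>E S"
    proof (rule PiE_I)
      fix z assume "z \<in> I \<times> J"
      then show "(\<lambda>(i, j)\<in>I \<times> J. Y i j) z \<in> S" using PiE_mem[OF mem] by auto
    qed simp
    show "(\<lambda>i\<in>I. \<lambda>j\<in>J. (\<lambda>(i, j)\<in>I \<times> J. Y i j) (i, j)) = Y"
    proof
      fix i show "(\<lambda>i\<in>I. \<lambda>j\<in>J. (\<lambda>(i, j)\<in>I \<times> J. Y i j) (i, j)) i = Y i"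
      proof (cases "i \<in> I")
        case True
        have "(\<lambda>j\<in>J. Y i j) = Y i" using mem[OF True] by (simp add: PiE_def extensional_restrict)
        then show ?thesis using True by (simp cong: restrict_cong)
      next
        case False
        then show ?thesis using PiE_arb[OF Y] by simp
      qed
    qed
  qed
  also have "\<dots> = (\<Prod>i\<in>I. \<Sum>r\<in>J \<rightarrow>\<^sub>E S. g i r)"
    using assms by (subst prod_sum_PiE) (auto intro!: finite_PiE)
  finally show ?thesis .
qed

section \<open>From the Gibbs measure to binomial weights\<close>

text \<open>Expanding the p-th power of a row sum produces exactly the sum over p-tuples. Stars thus
  depend on the out-degrees alone.\<close>

lemma star_density_eq:
  "star_density p n X = (\<Sum>i\<in>{1..n}. (\<Sum>j\<in>{1..n}. X (i, j)) ^ p) / real n ^ (p + 1)"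
proof -
  have "(\<Sum>j\<in>{1..p} \<rightarrow>\<^sub>E {1..n}. \<Prod>k\<in>{1..p}. X (i, j k)) = (\<Sum>j\<in>{1..n}. X (i, j)) ^ p" for i
    using prod_sum_PiE[of "{1..p}" "\<lambda>_. {1..n}" "\<lambda>_ j. X (i, j)"] by simp
  then show ?thesis by (simp add: star_density_def)
qed

text \<open>The powers of n balance: n^2 / n^(p + 1) times r^p is n (r / n)^p for a row with sum
  r.\<close>

lemma gibbs_weight_eq:
  assumes "n > 0"
  shows "gibbs_weight p \<beta>1 \<beta>2 n X = (\<Prod>i\<in>{1..n}. exp (real n *
    (\<beta>1 * ((\<Sum>j\<in>{1..n}. X (i, j)) / real n) + \<beta>2 * ((\<Sum>j\<in>{1..n}. X (i, j)) / real n) ^ p)))"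
proof -
  define r where "r i = (\<Sum>j\<in>{1..n}. X (i, j))" for i
  have "real n ^ 2 * (\<beta>1 * edge_density n X + \<beta>2 * star_density p n X) =
     (\<Sum>i\<in>{1..n}. \<beta>1 * r i) + (\<Sum>i\<in>{1..n}. \<beta>2 * (real n ^ 2 * r i ^ p / real n ^ (p + 1)))"
    using assms unfolding edge_density_def star_density_eq r_def[symmetric]
    by (simp add: algebra_simps sum_distrib_left sum_divide_distrib)
  also have "\<dots> = (\<Sum>i\<in>{1..n}. real n * (\<beta>1 * (r i / real n) + \<beta>2 * (r i / real n) ^ p))"
    unfolding sum.distrib[symmetric] using assms
    by (intro sum.cong) (auto simp: power_divide power2_eq_square field_simps)
  finally show ?thesis
    unfolding gibbs_weight_def r_def[symmetric] by (simp add: exp_sum)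
qed

lemma edge_probability_eq_sum:
  "edge_probability p \<beta>1 \<beta>2 n =
     (\<Sum>X | X \<in> digraphs n \<and> X (1, 2) = 1. gibbs_weight p \<beta>1 \<beta>2 n X) / partition_function p \<beta>1 \<beta>2 n"
proof -
  let ?A = "{X. X \<in> digraphs n \<and> X (1, 2) = 1}"
  have "emeasure (ergm p \<beta>1 \<beta>2 n) ?A = (\<Sum>X\<in>?A. ennreal (gibbs_weight p \<beta>1 \<beta>2 n X / partition_function p \<beta>1 \<beta>2 n))"
    unfolding ergm_def using finite_digraphs by (intro emeasure_point_measure_finite) auto
  also have "\<dots> = ennreal (\<Sum>X\<in>?A. gibbs_weight p \<beta>1 \<beta>2 n X / partition_function p \<beta>1 \<beta>2 n)"
    using partition_function_pos[of p \<beta>1 \<beta>2 n] by (intro sum_ennreal) (auto simp: gibbs_weight_def)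
  finally have "measure (ergm p \<beta>1 \<beta>2 n) ?A = (\<Sum>X\<in>?A. gibbs_weight p \<beta>1 \<beta>2 n X / partition_function p \<beta>1 \<beta>2 n)"
    using partition_function_pos[of p \<beta>1 \<beta>2 n]
    by (simp add: measure_def sum_nonneg gibbs_weight_def less_imp_le)
  then show ?thesis
    by (simp add: edge_probability_def ergm_def space_point_measure sum_divide_distrib)
qed

text \<open>The event concerns row 1 only, so the other n - 1 rows contribute the same factor
  \<open>B\<close> to numerator and partition function and cancel.\<close>

lemma edge_probability_eq_binomial:
  fixes p :: nat and \<beta>1 \<beta>2 :: real
  assumes "n \<ge> 2"
  defines "w \<equiv> \<lambda>k. real (n choose k) * exp (real n * (\<beta>1 * (real k / real n) + \<beta>2 * (real k / real n) ^ p))"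
  shows "edge_probability p \<beta>1 \<beta>2 n = (\<Sum>k\<le>n. real k / real n * w k) / (\<Sum>k\<le>n. w k)"
proof -
  define h where "h s = exp (real n * (\<beta>1 * (s / real n) + \<beta>2 * (s / real n) ^ p))" for s
  define J where "J = {1..n}"
  have J: "finite J" "card J = n" "1 \<in> J" "2 \<in> J" using assms by (auto simp: J_def)
  define A where "A = (\<Sum>r\<in>J \<rightarrow>\<^sub>E {0, 1}. r 2 * h (\<Sum>j\<in>J. r j))"
  define B where "B = (\<Sum>r\<in>J \<rightarrow>\<^sub>E {0, 1}. h (\<Sum>j\<in>J. r j))"
  have gw: "gibbs_weight p \<beta>1 \<beta>2 n X = (\<Prod>i\<in>J. h (\<Sum>j\<in>J. (\<lambda>j\<in>J. X (i, j)) j))" for X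
    using gibbs_weight_eq[of n p \<beta>1 \<beta>2 X] assms(1) by (simp add: h_def J_def)
  have Z: "partition_function p \<beta>1 \<beta>2 n = B ^ n"
    unfolding partition_function_def digraphs_def J_def[symmetric] gw
    using sum_PiE_rows[of J J "{0, 1}" "\<lambda>_ r. h (\<Sum>j\<in>J. r j)"] J by (simp add: B_def)
  \<comment> \<open>The entry is 0 or 1, so it serves as the indicator of the event.\<close>
  have "(\<Sum>X | X \<in> digraphs n \<and> X (1, 2) = 1. gibbs_weight p \<beta>1 \<beta>2 n X)
      = (\<Sum>X\<in>digraphs n. X (1, 2) * gibbs_weight p \<beta>1 \<beta>2 n X)"
  proof (rule sum.mono_neutral_cong_left)
    show "\<forall>X\<in>digraphs n - {X. X \<in> digraphs n \<and> X (1, 2) = 1}. X (1, 2) * gibbs_weight p \<beta>1 \<beta>2 n X = 0"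
    proof
      fix X assume X: "X \<in> digraphs n - {X. X \<in> digraphs n \<and> X (1, 2) = 1}"
      then have "X \<in> {1..n} \<times> {1..n} \<rightarrow>\<^sub>E {0, 1}" by (simp add: digraphs_def)
      then have "X (1, 2) \<in> {0, 1}" by (rule PiE_mem) (use assms(1) in auto)
      then show "X (1, 2) * gibbs_weight p \<beta>1 \<beta>2 n X = 0" using X by auto
    qed
  qed (auto simp: finite_digraphs)
  also have "\<dots> = (\<Sum>X\<in>J \<times> J \<rightarrow>\<^sub>E {0, 1}. \<Prod>i\<in>J. (\<lambda>i r. (if i = 1 then r 2 else 1) * h (\<Sum>j\<in>J. r j)) i (\<lambda>j\<in>J. X (i, j)))"
    unfolding digraphs_def J_def[symmetric] gw using J by (simp add: prod.distrib)
  also have "\<dots> = (\<Prod>i\<in>J. \<Sum>r\<in>J \<rightarrow>\<^sub>E {0, 1}. (if i = 1 then r 2 else 1) * h (\<Sum>j\<in>J. r j))"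
    using J by (intro sum_PiE_rows) auto
  also have "\<dots> = A * (\<Prod>i\<in>J - {1}. B)"
    using J by (subst prod.remove[of J 1]) (auto simp: A_def B_def intro!: prod.cong)
  also have "\<dots> = A * B ^ (n - 1)" using J by simp
  finally have "edge_probability p \<beta>1 \<beta>2 n = A * B ^ (n - 1) / B ^ n"
    unfolding edge_probability_eq_sum Z by simp
  moreover have "B ^ n = B * B ^ (n - 1)" "B \<noteq> 0"
    using partition_function_pos[of p \<beta>1 \<beta>2 n] assms(1) unfolding Z by (auto simp: power_eq_if)
  ultimately have "edge_probability p \<beta>1 \<beta>2 n = A / B" by simp
  also have "A = (\<Sum>k\<le>n. real k / real n * w k)"
    unfolding A_def sum_PiE_binary_coordinate[OF J(1,4)] J(2) by (simp add: w_def h_def)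
  also have "B = (\<Sum>k\<le>n. w k)"
    unfolding B_def sum_PiE_binary[OF J(1)] J(2) by (simp add: w_def h_def)
  finally show ?thesis .
qed

section \<open>The function ell at its maximizers\<close>

text \<open>One application of l'Hopital leaves half the difference quotient of \<open>g'\<close> at
  x.\<close>

lemma second_order_quotient_tendsto:
  fixes g g' :: "real \<Rightarrow> real"
  assumes g: "\<forall>\<^sub>F y in nhds x. (g has_real_derivative g' y) (at y)"
    and g': "g' x = 0" "(g' has_real_derivative c) (at x)"
  shows "((\<lambda>y. (g y - g x) / (y - x)\<^sup>2) \<longlongrightarrow> c / 2) (at x)"
proof (rule lhopital[where f' = g' and g' = "\<lambda>y. 2 * (y - x)"])
  have "(g has_real_derivative g' x) (at x)" using g by (rule eventually_nhds_x_imp_x)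
  then have "isCont g x" by (rule DERIV_isCont)
  then show "((\<lambda>y. g y - g x) \<longlongrightarrow> 0) (at x)" by (simp add: isCont_def LIM_zero)
  show "((\<lambda>y. (y - x)\<^sup>2) \<longlongrightarrow> 0) (at x)" by (auto intro!: tendsto_eq_intros)
  show "\<forall>\<^sub>F y in at x. (y - x)\<^sup>2 \<noteq> 0" "\<forall>\<^sub>F y in at x. 2 * (y - x) \<noteq> 0"
    by (auto simp: eventually_at_filter)
  have "\<forall>\<^sub>F y in at x. (g has_real_derivative g' y) (at y)"
    using g by (auto simp: eventually_at_filter elim: eventually_mono)
  then show "\<forall>\<^sub>F y in at x. ((\<lambda>y. g y - g x) has_real_derivative g' y) (at y)"
    by eventually_elim (auto intro!: derivative_eq_intros)
  show "\<forall>\<^sub>F y in at x. ((\<lambda>y. (y - x)\<^sup>2) has_real_derivative 2 * (y - x)) (at y)"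
    by (intro always_eventually allI) (auto intro!: derivative_eq_intros)
  have "((\<lambda>y. (g' y - g' x) / (y - x) / 2) \<longlongrightarrow> c / 2) (at x)"
    using g'(2) by (intro tendsto_intros) (auto simp: has_field_derivative_iff)
  then show "((\<lambda>y. g' y / (2 * (y - x))) \<longlongrightarrow> c / 2) (at x)"
    using g' by (simp add: field_simps)
qed

definition ell_deriv :: "nat \<Rightarrow> real \<Rightarrow> real \<Rightarrow> real \<Rightarrow> real" where
  "ell_deriv p \<beta>1 \<beta>2 x = \<beta>1 + \<beta>2 * (real p * x ^ (p - 1)) - ln x + ln (1 - x)"

text \<open>The last term combines 1/x and 1/(1 - x). For p < 2 the truncated exponent is harmless,
  since its coefficient p (p - 1) vanishes.\<close>

definition ell_deriv2 :: "nat \<Rightarrow> real \<Rightarrow> real \<Rightarrow> real" where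
  "ell_deriv2 p \<beta>2 x = \<beta>2 * (real p * (real (p - 1) * x ^ (p - 2))) - 1 / (x * (1 - x))"

lemma has_derivative_ell:
  assumes "0 < x" "x < 1"
  shows "(ell p \<beta>1 \<beta>2 has_real_derivative ell_deriv p \<beta>1 \<beta>2 x) (at x)"
proof -
  have "((\<lambda>x. x * ln x) has_real_derivative ln x + 1) (at x)"
    using assms by (auto intro!: derivative_eq_intros)
  moreover have "((\<lambda>x. (1 - x) * ln (1 - x)) has_real_derivative - ln (1 - x) - 1) (at x)"
    using assms by (auto intro!: derivative_eq_intros)
  moreover have "((\<lambda>x. \<beta>1 * x + \<beta>2 * x ^ p) has_real_derivative \<beta>1 + \<beta>2 * (real p * x ^ (p - 1))) (at x)"
    by (auto intro!: derivative_eq_intros)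
  ultimately have "((\<lambda>x. \<beta>1 * x + \<beta>2 * x ^ p - x * ln x - (1 - x) * ln (1 - x)) has_real_derivative
      \<beta>1 + \<beta>2 * (real p * x ^ (p - 1)) - (ln x + 1) - (- ln (1 - x) - 1)) (at x)"
    by (intro DERIV_diff)
  then show ?thesis unfolding ell_def[abs_def] ell_deriv_def by (rule DERIV_cong) simp
qed

lemma has_derivative_ell_deriv:
  assumes "0 < x" "x < 1"
  shows "(ell_deriv p \<beta>1 \<beta>2 has_real_derivative ell_deriv2 p \<beta>2 x) (at x)"
proof -
  have "((\<lambda>x. \<beta>2 * (real p * x ^ (p - 1))) has_real_derivative
      \<beta>2 * (real p * (real (p - 1) * x ^ (p - 1 - Suc 0)))) (at x)"
    by (intro DERIV_cmult DERIV_pow)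
  moreover have "((\<lambda>x. ln (1 - x) - ln x) has_real_derivative - 1 / (1 - x) - 1 / x) (at x)"
    using assms by (auto intro!: derivative_eq_intros)
  moreover have "- 1 / (1 - x) - 1 / x = - (1 / (x * (1 - x)))"
    using assms by (simp add: divide_simps)
  ultimately have "((\<lambda>x. \<beta>1 + (\<beta>2 * (real p * x ^ (p - 1)) + (ln (1 - x) - ln x))) has_real_derivative
      0 + (\<beta>2 * (real p * (real (p - 1) * x ^ (p - 1 - Suc 0))) + - (1 / (x * (1 - x))))) (at x)"
    by (intro DERIV_add DERIV_const) auto
  moreover have "ell_deriv p \<beta>1 \<beta>2 = (\<lambda>x. \<beta>1 + (\<beta>2 * (real p * x ^ (p - 1)) + (ln (1 - x) - ln x)))"
    by (auto simp: ell_deriv_def)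
  ultimately show ?thesis by (simp add: ell_deriv2_def numeral_2_eq_2)
qed

lemma eventually_nhds_unit_interval:
  fixes x :: real
  assumes "0 < x" "x < 1"
  shows "\<forall>\<^sub>F y in nhds x. 0 < y \<and> y < 1"
  using eventually_nhds_in_open[of "{0<..<1}" x] assms by simp

lemma deriv_deriv_ell:
  assumes "0 < x" "x < 1"
  shows "deriv (deriv (ell p \<beta>1 \<beta>2)) x = ell_deriv2 p \<beta>2 x"
proof -
  have "\<forall>\<^sub>F y in nhds x. deriv (ell p \<beta>1 \<beta>2) y = ell_deriv p \<beta>1 \<beta>2 y"
    using eventually_nhds_unit_interval[OF assms]
    by eventually_elim (auto intro: DERIV_imp_deriv has_derivative_ell)
  then have "deriv (deriv (ell p \<beta>1 \<beta>2)) x = deriv (ell_deriv p \<beta>1 \<beta>2) x"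
    by (intro deriv_cong_ev) auto
  then show ?thesis using has_derivative_ell_deriv[OF assms] by (metis DERIV_imp_deriv)
qed

lemma ell_eq: "\<beta>1 * x + \<beta>2 * x ^ p + binary_entropy x = ell p \<beta>1 \<beta>2 x"
  by (simp add: ell_def binary_entropy_def)

lemma ell_deriv_zero_at_maximizer:
  assumes "x \<in> global_maximizers p \<beta>1 \<beta>2" "0 < x" "x < 1"
  shows "ell_deriv p \<beta>1 \<beta>2 x = 0"
proof (rule DERIV_local_max[OF has_derivative_ell[OF assms(2,3)]])
  show "0 < min x (1 - x)" using assms by simp
  show "\<forall>y. \<bar>x - y\<bar> < min x (1 - x) \<longrightarrow> ell p \<beta>1 \<beta>2 y \<le> ell p \<beta>1 \<beta>2 x"
  proof (intro allI impI)
    fix y assume "\<bar>x - y\<bar> < min x (1 - x)"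
    then have "y \<in> {0..1}" by auto
    then show "ell p \<beta>1 \<beta>2 y \<le> ell p \<beta>1 \<beta>2 x" using assms(1) by (simp add: global_maximizers_def)
  qed
qed

text \<open>The derivative z^(p - 2) (p - 1 - p z) changes sign at (p - 1) / p. The function matters
  because y (1 - y) ell''(y) is a multiple of it minus 1.\<close>

lemma power_times_one_minus_less:
  fixes x y :: real
  assumes p: "p \<ge> 2" and x: "0 < x" "x < 1"
    and between: "x < y \<and> y \<le> (real p - 1) / real p \<or> (real p - 1) / real p \<le> y \<and> y < x"
  shows "x ^ (p - 1) * (1 - x) < y ^ (p - 1) * (1 - y)"
proof -
  obtain q where q: "p = Suc (Suc q)" using p by (metis Suc_le_D numeral_2_eq_2 Suc_le_mono)
  define m where "m y = y ^ (p - 1) * (1 - y)" for y :: real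
  have deriv: "(m has_real_derivative z ^ q * (real p - 1 - real p * z)) (at z)" for z
  proof -
    have "m = (\<lambda>y. y ^ Suc q - y ^ Suc (Suc q))" by (auto simp: m_def q algebra_simps)
    moreover have "real (Suc q) * z ^ q - real (Suc (Suc q)) * z ^ Suc q = z ^ q * (real p - 1 - real p * z)"
      by (simp add: q algebra_simps)
    ultimately show ?thesis
      using DERIV_diff[OF DERIV_pow[of "Suc q" z] DERIV_pow[of "Suc (Suc q)" z]] by (simp del: power_Suc)
  qed
  have cont: "continuous_on A m" for A unfolding m_def by (intro continuous_intros)
  have c: "(real p - 1) / real p > 0" using p by simp
  from between show ?thesis unfolding m_def[symmetric]
  proof
    assume A: "x < y \<and> y \<le> (real p - 1) / real p"
    show "m x < m y"
    proof (rule DERIV_pos_imp_increasing_open[OF _ _ cont])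
      fix z assume z: "x < z" "z < y"
      then have "z < (real p - 1) / real p" using A by linarith
      then have "0 < z ^ q * (real p - 1 - real p * z)"
        using z x p by (intro mult_pos_pos) (auto simp: field_simps)
      then show "\<exists>d. (m has_real_derivative d) (at z) \<and> 0 < d" using deriv by blast
    qed (use A in auto)
  next
    assume A: "(real p - 1) / real p \<le> y \<and> y < x"
    show "m x < m y"
    proof (rule DERIV_neg_imp_decreasing_open[OF _ _ cont])
      fix z assume z: "y < z" "z < x"
      then have "z > (real p - 1) / real p" using A by linarith
      moreover from this have "0 < z" using c by linarith
      ultimately have "z ^ q * (real p - 1 - real p * z) < 0"
        using p by (intro mult_pos_neg) (auto simp: field_simps)
      then show "\<exists>d. (m has_real_derivative d) (at z) \<and> d < 0" using deriv by blast
    qed (use A in auto)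
  qed
qed

text \<open>If the second derivative were nonnegative at a maximizer, it would be positive
  all the way to \<open>(p - 1) / p\<close>, where \<open>x\<^sup>p\<^sup>-\<^sup>1 (1 - x)\<close> peaks, so moving there would increase \<open>ell\<close>.\<close>

lemma ell_deriv2_neg_at_maximizer:
  assumes p: "p \<ge> 2" and x: "0 < x" "x < 1" and max: "x \<in> global_maximizers p \<beta>1 \<beta>2"
    and ne: "x \<noteq> (real p - 1) / real p"
  shows "ell_deriv2 p \<beta>2 x < 0"
proof (rule ccontr)
  assume "\<not> ell_deriv2 p \<beta>2 x < 0"
  define c where "c = (real p - 1) / real p"
  have c: "0 < c" "c < 1" using p by (auto simp: c_def)
  define m where "m y = y ^ (p - 1) * (1 - y)" for y :: real
  have eq: "y * (1 - y) * ell_deriv2 p \<beta>2 y = \<beta>2 * (real p * real (p - 1)) * m y - 1"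
    if "0 < y" "y < 1" for y
  proof -
    have "y ^ (p - 1) = y * y ^ (p - 2)" using p by (metis Suc_1 Suc_diff_le diff_Suc_Suc power_Suc)
    moreover have "y * (1 - y) * (A - 1 / (y * (1 - y))) = y * (1 - y) * A - 1" for A
      using that by (subst right_diff_distrib) simp
    ultimately show ?thesis unfolding ell_deriv2_def m_def by simp
  qed
  have mpos: "m y > 0" if "0 < y" "y < 1" for y using that by (simp add: m_def)
  have "x * (1 - x) * ell_deriv2 p \<beta>2 x \<ge> 0"
    using x \<open>\<not> ell_deriv2 p \<beta>2 x < 0\<close> by (intro mult_nonneg_nonneg) auto
  \<comment> \<open>A nonnegative second derivative at x forces \<beta>2 > 0; the comparison of
    \<open>m\<close> values therefore keeps its direction.\<close>
  then have ge1: "\<beta>2 * (real p * real (p - 1)) * m x \<ge> 1" using eq[OF x] by linarith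
  then have "\<beta>2 * (real p * real (p - 1)) * m x > 0" by linarith
  then have b: "\<beta>2 * (real p * real (p - 1)) > 0" using mpos[OF x] by (simp add: zero_less_mult_iff)
  have pos: "ell_deriv2 p \<beta>2 y > 0" if "0 < y" "y < 1" "x < y \<and> y \<le> c \<or> c \<le> y \<and> y < x" for y
  proof -
    have "m x < m y" unfolding m_def using that p x unfolding c_def by (intro power_times_one_minus_less)
    then have "\<beta>2 * (real p * real (p - 1)) * m x < \<beta>2 * (real p * real (p - 1)) * m y"
      using b by (rule mult_strict_left_mono)
    then have "y * (1 - y) * ell_deriv2 p \<beta>2 y > 0" using eq[of y] that ge1 by linarith
    moreover have "y * (1 - y) > 0" using that by simp
    ultimately show ?thesis by (simp add: zero_less_mult_iff)
  qed
  have cont1: "continuous_on A (ell_deriv p \<beta>1 \<beta>2)" if "A \<subseteq> {0<..<1}" for A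
  proof (rule DERIV_continuous_on)
    fix y assume "y \<in> A"
    then show "(ell_deriv p \<beta>1 \<beta>2 has_real_derivative ell_deriv2 p \<beta>2 y) (at y within A)"
      using that by (intro has_field_derivative_at_within[OF has_derivative_ell_deriv]) auto
  qed
  have cont0: "continuous_on A (ell p \<beta>1 \<beta>2)" if "A \<subseteq> {0<..<1}" for A
  proof (rule DERIV_continuous_on)
    fix y assume "y \<in> A"
    then show "(ell p \<beta>1 \<beta>2 has_real_derivative ell_deriv p \<beta>1 \<beta>2 y) (at y within A)"
      using that by (intro has_field_derivative_at_within[OF has_derivative_ell]) auto
  qed
  have zero: "ell_deriv p \<beta>1 \<beta>2 x = 0" by (rule ell_deriv_zero_at_maximizer[OF max x])
  have "ell p \<beta>1 \<beta>2 c > ell p \<beta>1 \<beta>2 x"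
  proof (cases "x < c")
    case True
    show ?thesis
    proof (rule DERIV_pos_imp_increasing_open[OF True _ cont0])
      fix y assume y: "x < y" "y < c"
      \<comment> \<open>The first derivative starts at 0 in x and increases towards c, so it is
        positive in between.\<close>
      have "ell_deriv p \<beta>1 \<beta>2 x < ell_deriv p \<beta>1 \<beta>2 y"
      proof (rule DERIV_pos_imp_increasing_open[OF y(1) _ cont1])
        fix z assume z: "x < z" "z < y"
        then have "(ell_deriv p \<beta>1 \<beta>2 has_real_derivative ell_deriv2 p \<beta>2 z) (at z) \<and> 0 < ell_deriv2 p \<beta>2 z"
          using x y c by (intro conjI has_derivative_ell_deriv pos) auto
        then show "\<exists>d. (ell_deriv p \<beta>1 \<beta>2 has_real_derivative d) (at z) \<and> 0 < d" by blast
      qed (use x y c in auto)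
      then have "(ell p \<beta>1 \<beta>2 has_real_derivative ell_deriv p \<beta>1 \<beta>2 y) (at y) \<and> 0 < ell_deriv p \<beta>1 \<beta>2 y"
        using x y c zero by (intro conjI has_derivative_ell) auto
      then show "\<exists>d. (ell p \<beta>1 \<beta>2 has_real_derivative d) (at y) \<and> 0 < d" by blast
    qed (use x c in auto)
  next
    case False
    then have cx: "c < x" using ne by (simp add: c_def)
    show ?thesis
    proof (rule DERIV_neg_imp_decreasing_open[OF cx _ cont0])
      fix y assume y: "c < y" "y < x"
      \<comment> \<open>Here the first derivative increases up to 0 at x, so it is negative on the
        way from c.\<close>
      have "ell_deriv p \<beta>1 \<beta>2 y < ell_deriv p \<beta>1 \<beta>2 x"
      proof (rule DERIV_pos_imp_increasing_open[OF y(2) _ cont1])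
        fix z assume z: "y < z" "z < x"
        then have "(ell_deriv p \<beta>1 \<beta>2 has_real_derivative ell_deriv2 p \<beta>2 z) (at z) \<and> 0 < ell_deriv2 p \<beta>2 z"
          using x y c by (intro conjI has_derivative_ell_deriv pos) auto
        then show "\<exists>d. (ell_deriv p \<beta>1 \<beta>2 has_real_derivative d) (at z) \<and> 0 < d" by blast
      qed (use x y c in auto)
      then have "(ell p \<beta>1 \<beta>2 has_real_derivative ell_deriv p \<beta>1 \<beta>2 y) (at y) \<and> ell_deriv p \<beta>1 \<beta>2 y < 0"
        using x y c zero by (intro conjI has_derivative_ell) auto
      then show "\<exists>d. (ell p \<beta>1 \<beta>2 has_real_derivative d) (at y) \<and> d < 0" by blast
    qed (use x c in auto)
  qed
  moreover have "ell p \<beta>1 \<beta>2 c \<le> ell p \<beta>1 \<beta>2 x" using max c by (auto simp: global_maximizers_def)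
  ultimately show False by simp
qed

text \<open>\<open>Q\<close> is the second-order quotient with its limit filled in at x, so the
  identity holds by construction and the content is continuity at x. The first-order term is absent
  because x is an interior maximizer.\<close>

lemma ell_expansion_at_maximizer:
  assumes x: "0 < x" "x < 1" and max: "x \<in> global_maximizers p \<beta>1 \<beta>2"
  obtains Q where "\<And>y. ell p \<beta>1 \<beta>2 y = ell p \<beta>1 \<beta>2 x + Q y * (y - x)\<^sup>2"
    "isCont Q x" "Q x = ell_deriv2 p \<beta>2 x / 2"
proof
  define Q where "Q y = (if y = x then ell_deriv2 p \<beta>2 x / 2 else (ell p \<beta>1 \<beta>2 y - ell p \<beta>1 \<beta>2 x) / (y - x)\<^sup>2)" for y
  show "ell p \<beta>1 \<beta>2 y = ell p \<beta>1 \<beta>2 x + Q y * (y - x)\<^sup>2" for y by (simp add: Q_def)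
  show Qx: "Q x = ell_deriv2 p \<beta>2 x / 2" by (simp add: Q_def)
  have "((\<lambda>y. (ell p \<beta>1 \<beta>2 y - ell p \<beta>1 \<beta>2 x) / (y - x)\<^sup>2) \<longlongrightarrow> ell_deriv2 p \<beta>2 x / 2) (at x)"
  proof (rule second_order_quotient_tendsto)
    show "\<forall>\<^sub>F y in nhds x. (ell p \<beta>1 \<beta>2 has_real_derivative ell_deriv p \<beta>1 \<beta>2 y) (at y)"
      using eventually_nhds_unit_interval[OF x] by eventually_elim (auto intro: has_derivative_ell)
  qed (use ell_deriv_zero_at_maximizer[OF max x] has_derivative_ell_deriv[OF x] in auto)
  moreover have "\<forall>\<^sub>F y in at x. (ell p \<beta>1 \<beta>2 y - ell p \<beta>1 \<beta>2 x) / (y - x)\<^sup>2 = Q y"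
    by (auto simp: eventually_at_filter Q_def)
  ultimately have "(Q \<longlongrightarrow> ell_deriv2 p \<beta>2 x / 2) (at x)" by (rule Lim_transform_eventually)
  then show "isCont Q x" by (simp add: isCont_def Qx)
qed

lemma ell_less_off_maximizers:
  assumes "x \<in> global_maximizers p \<beta>1 \<beta>2" "y \<in> {0..1}" "y \<notin> global_maximizers p \<beta>1 \<beta>2"
  shows "ell p \<beta>1 \<beta>2 y < ell p \<beta>1 \<beta>2 x"
  using assms unfolding global_maximizers_def by (auto simp: not_le)

section \<open>Limits of the edge probability\<close>

lemma edge_probability_tendstoI:
  fixes \<beta>1 \<beta>2 :: real and p :: nat
  defines "f \<equiv> \<lambda>y. \<beta>1 * y + \<beta>2 * y ^ p"
  assumes "(\<lambda>n. (\<Sum>k\<le>n. real k / real n * binomial_weight f l n k) / (\<Sum>k\<le>n. binomial_weight f l n k)) \<longlonglongrightarrow> z"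
  shows "edge_probability p \<beta>1 \<beta>2 \<longlonglongrightarrow> z"
proof (rule Lim_transform_eventually[OF assms(2)])
  show "\<forall>\<^sub>F n in sequentially. (\<Sum>k\<le>n. real k / real n * binomial_weight f l n k) / (\<Sum>k\<le>n. binomial_weight f l n k)
    = edge_probability p \<beta>1 \<beta>2 n"
    using eventually_ge_at_top[of 2]
  proof eventually_elim
    case (elim n)
    show ?case
      unfolding edge_probability_eq_binomial[OF elim] binomial_weight_ratio_shift[symmetric, where l=l]
      by (simp add: binomial_weight_def f_def)
  qed
qed

lemma edge_probability_tendsto_unique:
  assumes x: "0 < x" "x < 1" and max: "global_maximizers p \<beta>1 \<beta>2 = {x}"
  shows "edge_probability p \<beta>1 \<beta>2 \<longlonglongrightarrow> x"
proof (rule edge_probability_tendstoI[where l=0], rule binomial_weight_concentration[OF x])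
  show "continuous_on {0..1} (\<lambda>y. \<beta>1 * y + \<beta>2 * y ^ p)" by (intro continuous_intros)
  show "\<beta>1 * y + \<beta>2 * y ^ p + binary_entropy y < \<beta>1 * x + \<beta>2 * x ^ p + binary_entropy x"
    if "y \<in> {0..1}" "y \<noteq> x" for y
    unfolding ell_eq using that max by (intro ell_less_off_maximizers) auto
qed

lemma edge_probability_tendsto_mixture:
  assumes p: "p \<ge> 2" and x: "0 < x1" "x1 < (real p - 1) / real p" "(real p - 1) / real p < x2" "x2 < 1"
    and max: "global_maximizers p \<beta>1 \<beta>2 = {x1, x2}"
  shows "edge_probability p \<beta>1 \<beta>2 \<longlonglongrightarrow>
    mixture_weight p \<beta>1 \<beta>2 x1 x2 * x1 + (1 - mixture_weight p \<beta>1 \<beta>2 x1 x2) * x2"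
proof -
  define f where "f = (\<lambda>y. \<beta>1 * y + \<beta>2 * y ^ p)"
  define l where "l = ell p \<beta>1 \<beta>2 x1"
  define a where "a x = - (ell_deriv2 p \<beta>2 x / 2)" for x
  have x': "x1 < x2" "x1 < 1" "0 < x2" using x by linarith+
  have mem: "x1 \<in> global_maximizers p \<beta>1 \<beta>2" "x2 \<in> global_maximizers p \<beta>1 \<beta>2" using max by auto
  \<comment> \<open>Both maximizers have the same value, so one level \<open>l\<close> normalizes
    both windows.\<close>
  have eq: "ell p \<beta>1 \<beta>2 x2 = l"
    using mem by (auto simp: global_maximizers_def l_def intro: antisym)
  have ell: "f y + binary_entropy y = ell p \<beta>1 \<beta>2 y" for y by (simp add: f_def ell_eq)
  have neg: "ell_deriv2 p \<beta>2 x1 < 0" "ell_deriv2 p \<beta>2 x2 < 0"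
    using x x' mem p by (auto intro!: ell_deriv2_neg_at_maximizer)
  then have a: "a x1 > 0" "a x2 > 0" by (auto simp: a_def)
  obtain Q1 where Q1: "\<And>y. ell p \<beta>1 \<beta>2 y = l + Q1 y * (y - x1)\<^sup>2" "isCont Q1 x1" "Q1 x1 = - a x1"
    using ell_expansion_at_maximizer[OF x(1) x'(2) mem(1)] unfolding l_def a_def by auto
  obtain Q2 where Q2: "\<And>y. ell p \<beta>1 \<beta>2 y = l + Q2 y * (y - x2)\<^sup>2" "isCont Q2 x2" "Q2 x2 = - a x2"
    using ell_expansion_at_maximizer[OF x'(3) x(4) mem(2)] unfolding eq a_def by auto
  define C where "C x = exp (- lim stirling_error) * sqrt (pi / a x) / sqrt (x * (1 - x))" for x
  \<comment> \<open>Used below with the identity for the numerator of the mean and with the constant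
    1 for its denominator.\<close>
  have laplace: "(\<lambda>n. \<Sum>k\<le>n. \<phi> (real k / real n) * binomial_weight f l n k) \<longlonglongrightarrow> \<phi> x1 * C x1 + \<phi> x2 * C x2"
    if "continuous_on UNIV \<phi>" "\<And>y. y \<in> {0..1} \<Longrightarrow> \<bar>\<phi> y\<bar> \<le> 1" for \<phi> :: "real \<Rightarrow> real"
    unfolding C_def
  proof (rule laplace_two_points[where Q=Q1 and R=Q2 and M=1])
    show "continuous_on {0..1} f" unfolding f_def by (intro continuous_intros)
    show "f y + binary_entropy y < l" if "y \<in> {0..1}" "y \<noteq> x1" "y \<noteq> x2" for y
      unfolding ell l_def using that max by (intro ell_less_off_maximizers) auto
    show "isCont \<phi> x1" "isCont \<phi> x2" using that by (auto simp: continuous_on_eq_continuous_at)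
  qed (use x x' a Q1 Q2 ell that in auto)
  define L where "L = laplace_factor p \<beta>1 \<beta>2"
  \<comment> \<open>Since a = |ell''| / 2, the mass at x is a constant over the Laplace factor. This
    inversion is why the weight of x1 has the factor at x2 in its numerator.\<close>
  have CL: "C x = exp (- lim stirling_error) * sqrt (2 * pi) / L x" and Lpos: "L x > 0" if "0 < x" "x < 1" "ell_deriv2 p \<beta>2 x < 0" for x
  proof -
    have L: "L x = sqrt (x * (1 - x)) * sqrt (2 * a x)"
      using that by (simp add: L_def laplace_factor_def deriv_deriv_ell a_def flip: real_sqrt_mult)
    show "L x > 0" unfolding L using that by (simp add: a_def)
    have "sqrt (pi / a x) = sqrt (2 * pi) / sqrt (2 * a x)"
      using that by (simp add: a_def flip: real_sqrt_divide)
    then show "C x = exp (- lim stirling_error) * sqrt (2 * pi) / L x"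
      unfolding C_def L by simp
  qed
  define K where "K = exp (- lim stirling_error) * sqrt (2 * pi)"
  have K: "K > 0" by (simp add: K_def)
  have C: "C x1 = K / L x1" "C x2 = K / L x2" "L x1 > 0" "L x2 > 0"
    using CL Lpos x x' neg unfolding K_def by auto
  have "(\<lambda>n. (\<Sum>k\<le>n. real k / real n * binomial_weight f l n k) / (\<Sum>k\<le>n. binomial_weight f l n k)) \<longlonglongrightarrow>
    (x1 * C x1 + x2 * C x2) / (C x1 + C x2)"
    using laplace[of "\<lambda>y. y"] laplace[of "\<lambda>_. 1"] C K
    by (intro tendsto_divide) (auto simp: add_pos_pos less_imp_neq[symmetric])
  then have "edge_probability p \<beta>1 \<beta>2 \<longlonglongrightarrow> (x1 * C x1 + x2 * C x2) / (C x1 + C x2)"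
    unfolding f_def by (rule edge_probability_tendstoI)
  moreover have "C x1 / (C x1 + C x2) = mixture_weight p \<beta>1 \<beta>2 x1 x2"
    "1 - mixture_weight p \<beta>1 \<beta>2 x1 x2 = C x2 / (C x1 + C x2)"
  proof -
    have "K / u / (K / u + K / v) = v / (u + v)" "1 - v / (u + v) = K / v / (K / u + K / v)"
      if "u > 0" "v > 0" for u v
    proof -
      have sum: "K / u + K / v = K * (u + v) / (u * v)" "u + v \<noteq> 0"
        using that by (auto simp: field_simps)
      then have "1 - v / (u + v) = u / (u + v)" by (simp add: field_simps)
      then show "K / u / (K / u + K / v) = v / (u + v)" "1 - v / (u + v) = K / v / (K / u + K / v)"
        using that K unfolding sum(1) by simp_all
    qed
    from this[OF C(3,4)] show "C x1 / (C x1 + C x2) = mixture_weight p \<beta>1 \<beta>2 x1 x2"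
      "1 - mixture_weight p \<beta>1 \<beta>2 x1 x2 = C x2 / (C x1 + C x2)"
      unfolding mixture_weight_def L_def[symmetric] C(1,2) .
  qed
  moreover have "(x1 * C x1 + x2 * C x2) / (C x1 + C x2) = C x1 / (C x1 + C x2) * x1 + C x2 / (C x1 + C x2) * x2"
    by (simp add: add_divide_distrib mult.commute)
  ultimately show ?thesis by simp
qed

theorem theorem7:
  fixes p :: nat and \<beta>1 \<beta>2 :: real and q :: "real \<Rightarrow> real"
  assumes "p \<ge> 2"
    and "phase_transition_curve p q"
  shows "(\<not> on_curve p q \<beta>1 \<beta>2 \<or> critical_point p \<beta>1 \<beta>2 \<longrightarrow>
            (\<forall>x. global_maximizers p \<beta>1 \<beta>2 = {x} \<longrightarrow>
               edge_probability p \<beta>1 \<beta>2 \<longlonglongrightarrow> x)) \<and>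
         (on_curve p q \<beta>1 \<beta>2 \<and> \<not> critical_point p \<beta>1 \<beta>2 \<longrightarrow>
            (\<forall>x1 x2. global_maximizers p \<beta>1 \<beta>2 = {x1, x2} \<and> x1 < x2 \<longrightarrow>
               edge_probability p \<beta>1 \<beta>2 \<longlonglongrightarrow>
                 mixture_weight p \<beta>1 \<beta>2 x1 x2 * x1 + (1 - mixture_weight p \<beta>1 \<beta>2 x1 x2) * x2))"
proof (intro conjI impI allI)
  fix x assume "\<not> on_curve p q \<beta>1 \<beta>2 \<or> critical_point p \<beta>1 \<beta>2" and x: "global_maximizers p \<beta>1 \<beta>2 = {x}"
  then obtain x' where "0 < x'" "x' < 1" "global_maximizers p \<beta>1 \<beta>2 = {x'}"
    using assms(2) unfolding phase_transition_curve_def by blast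
  then show "edge_probability p \<beta>1 \<beta>2 \<longlonglongrightarrow> x"
    using x edge_probability_tendsto_unique by auto
next
  fix x1 x2 assume "on_curve p q \<beta>1 \<beta>2 \<and> \<not> critical_point p \<beta>1 \<beta>2"
    and x: "global_maximizers p \<beta>1 \<beta>2 = {x1, x2} \<and> x1 < x2"
  then obtain y1 y2 where y: "0 < y1" "y1 < (real p - 1) / real p" "(real p - 1) / real p < y2" "y2 < 1"
    "global_maximizers p \<beta>1 \<beta>2 = {y1, y2}"
    using assms(2) unfolding phase_transition_curve_def by blast
  \<comment> \<open>The separation by (p - 1) / p gives y1 < y2, so the ordering x1 < x2 fixes the
    matching of the two pairs.\<close>
  then have "x1 = y1" "x2 = y2" using x by (auto simp: doubleton_eq_iff)
  then show "edge_probability p \<beta>1 \<beta>2 \<longlonglongrightarrow>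
      mixture_weight p \<beta>1 \<beta>2 x1 x2 * x1 + (1 - mixture_weight p \<beta>1 \<beta>2 x1 x2) * x2"
    using y by (intro edge_probability_tendsto_mixture assms(1)) auto
qed

end
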